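(* Let $I \geq 1$ be an integer. For each $i = 1,\dots,I$, let $c_i \in \mathbb{R}$, let $\{M_i(t) : t \geq 0\}$ be a (homogeneous) Poisson process with rate $\lambda_i > 0$, and let $X_{i1}, X_{i2}, \dots$ be i.i.d. real-valued random variables, independent of $M_i$, with $\mathbb{E}[X_{i1}] < c_i$, $\mathbb{P}(X_{i1} > c_i) > 0$, and such that the log-moment generating function $s \mapsto \log \mathbb{E}[e^{sX_{i1}}]$ is finite for all real $s$ in an open neighbourhood of the origin. Assume that the $2I$ objects $M_1,\dots,M_I$, $(X_{1k})_{k\ge 1},\dots,(X_{Ik})_{k \ge 1}$ are mutually independent. Put $c = c_1 + \dots + c_I$. Then $$\lim_{t \to \infty} \frac{1}{t} \log \mathbb{P}\left(\sum_{i=1}^I \sum_{k=1}^{M_i(t)} X_{ik} > ct\right) = \inf_{s > 0} \sum_{i=1}^I \left[\lambda_i\left(\mathbb{E}[e^{sX_{i1}}] - 1\right) - c_i s\right],$$ where $t \to \infty$ through the real numbers.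
   Context: Conventions: the Poisson processes start at $M_i(0)=0$, and an empty sum (when $M_i(t)=0$) equals $0$. For $s>0$ the expectation $\mathbb{E}[e^{sX_{i1}}]$ takes values in $(0,\infty]$, so the expression inside the infimum may equal $+\infty$ for some $s$. *)

theory Defs
  imports "HOL-Probability.Probability"
begin

(* The library logarithm satisfies ln 0 = 0; here log 0 is minus infinity. *)
definition ext_ln :: "ennreal \<Rightarrow> ereal" where
  "ext_ln x = (if x = 0 then -\<infinity> else if x = \<infinity> then \<infinity> else ereal (ln (enn2real x)))"

definition mgf :: "'a measure \<Rightarrow> ('a \<Rightarrow> real) \<Rightarrow> real \<Rightarrow> ennreal" where
  "mgf P Y s = (\<integral>\<^sup>+ \<omega>. ennreal (exp (s * Y \<omega>)) \<partial>P)"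

definition log_mgf :: "'a measure \<Rightarrow> ('a \<Rightarrow> real) \<Rightarrow> real \<Rightarrow> ereal" where
  "log_mgf P Y s = ext_ln (mgf P Y s)"

(* Homogeneous Poisson process in its counting-process definition. The paths are
   nondecreasing, so the truncated subtraction on nat below is exact. No path regularity
   beyond monotonicity is required; right-continuous versions are included.  *)
definition poisson_process :: "'a measure \<Rightarrow> real \<Rightarrow> (real \<Rightarrow> 'a \<Rightarrow> nat) \<Rightarrow> bool" where
  "poisson_process P rate N \<longleftrightarrow>
     (\<forall>t\<ge>0. N t \<in> measurable P (count_space UNIV)) \<and>
     (\<forall>\<omega>\<in>space P. N 0 \<omega> = 0 \<and> mono_on {0..} (\<lambda>t. N t \<omega>)) \<and>
     (\<forall>n (t :: nat \<Rightarrow> real). 0 \<le> t 0 \<and> strict_mono_on {0..n} t \<longrightarrow>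
        prob_space.indep_vars P (\<lambda>_. count_space UNIV)
          (\<lambda>k \<omega>. N (t (Suc k)) \<omega> - N (t k) \<omega>) {0..<n}) \<and>
     (\<forall>s t. 0 \<le> s \<and> s < t \<longrightarrow>
        distr P (count_space UNIV) (\<lambda>\<omega>. N t \<omega> - N s \<omega>) =
        measure_pmf (poisson_pmf (rate * (t - s))))"

definition iid_real :: "'a measure \<Rightarrow> (nat \<Rightarrow> 'a \<Rightarrow> real) \<Rightarrow> nat set \<Rightarrow> bool" where
  "iid_real P Y K \<longleftrightarrow>
     prob_space.indep_vars P (\<lambda>_. borel) Y K \<and>
     (\<forall>k\<in>K. \<forall>l\<in>K. distr P borel (Y k) = distr P borel (Y l))"

(* The events generated by a whole family (Y t), t in T, i.e. by the random element
   with values in the product space indexed by T. *)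
definition process_events ::
  "'a measure \<Rightarrow> 'b measure \<Rightarrow> 't set \<Rightarrow> ('t \<Rightarrow> 'a \<Rightarrow> 'b) \<Rightarrow> 'a set set" where
  "process_events P S T Y =
     sets (vimage_algebra (space P) (\<lambda>\<omega>. \<lambda>t\<in>T. Y t \<omega>) (PiM T (\<lambda>_. S)))"

end

theory Submission
  imports Defs "HOL-Real_Asymp.Real_Asymp"
begin

text \<open>
  Let \<open>S t\<close> be the aggregate of the \<open>I\<close> streams, \<open>W t = S t - c t\<close> its excess over the line of
  slope \<open>c = c 1 + \<dots> + c I\<close>, and \<open>L s = (\<Sum>i. rate i * (E exp (s * X i 1) - 1) - c i * s)\<close>.
  At a fixed time the counts are independent Poisson variables that are independent of the jumps,
  and conditioning on the counts gives the exact formula \<open>E exp (s * W t) = exp (t * L s)\<close>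
  (\<open>mgf_total\<close>, \<open>mgf_excess\<close>). Both bounds rest on this formula.

  The upper bound is Markov's inequality for \<open>exp (s * W t)\<close> with each \<open>s > 0\<close> at which \<open>L\<close> is
  finite (\<open>chernoff_bound\<close>).

  The lower bound is Cramer's exponential tilting. Suppose first that \<open>L\<close> is finite and
  differentiable on the half-line and tends to infinity, and let \<open>s\<^sub>0\<close> be its largest
  minimiser there. For \<open>s\<close> slightly to the right of \<open>s\<^sub>0\<close>, the law of \<open>W t\<close> with density
  proportional to \<open>exp (s * W t)\<close> concentrates on a window \<open>0 < W t \<le> e * t\<close>: the mass to the
  left of the window is controlled by \<open>L s\<^sub>0 < L s\<close> and the mass to its right by the slope of \<open>L\<close>
  at \<open>s\<^sub>0\<close>. On the window the density is at most \<open>exp (s * e * t)\<close>, so \<open>P (W t > 0)\<close> is at least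
  about \<open>exp (t * (L s - s * e))\<close>. The product \<open>s * e\<close> can be made arbitrarily small: either
  \<open>s\<^sub>0 > 0\<close>, then \<open>L\<close> has slope \<open>0\<close> there and \<open>e\<close> may be small, or \<open>s\<^sub>0 = 0\<close> and \<open>s\<close> itself
  may be small. The tilted law never has to be constructed, since the estimate is a pointwise
  inequality between exponentials (\<open>tilted_mass_inequality\<close>, \<open>exponential_lower_bound\<close>).

  In general \<open>L\<close> may become infinite at a finite point and have its minimiser at the edge of its domain, where the
  slope argument fails. Truncating
  the jumps from above at level \<open>n\<close> only decreases the aggregate, and makes the exponent \<open>L\<^sub>n\<close> finite
  and differentiable on the half-line. It tends to infinity because the jumps of stream \<open>i\<close> exceed \<open>c i\<close>
  with positive probability: either \<open>c i < 0\<close>, or these jumps are positive. Finally, the truncation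
  does not lower the bound in the limit. If \<open>L\<^sub>n \<le> a\<close> somewhere for every \<open>n\<close>, then the nested
  compact sets \<open>{s \<ge> 0. L\<^sub>n s \<le> a}\<close> have a common point, and \<open>L \<le> a\<close> there by monotone convergence
  (\<open>ex_level_above\<close>).
\<close>

section \<open>Differentiability of moment generating functions\<close>

lemma exp_quadratic_bound: "exp x \<le> 1 + x + x\<^sup>2 * exp \<bar>x\<bar>" for x :: real
proof -
  have a: "exp x - 1 \<le> x * exp x"
    using exp_ge_add_one_self[of "- x"] by (simp add: exp_minus field_simps)
  have b: "\<bar>exp x - 1\<bar> \<le> \<bar>x\<bar> * exp \<bar>x\<bar>"
  proof (cases "0 \<le> x")
    case True
    then show ?thesis using a by simp
  next
    case False
    then have "\<bar>exp x - 1\<bar> \<le> \<bar>x\<bar> * 1"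
      using exp_ge_add_one_self[of x] by (simp add: abs_if del: exp_ge_add_one_self)
    also have "\<dots> \<le> \<bar>x\<bar> * exp \<bar>x\<bar>" by (intro mult_left_mono) auto
    finally show ?thesis .
  qed
  have "exp x - 1 - x \<le> x * (exp x - 1)" using a by (simp add: algebra_simps)
  also have "\<dots> \<le> \<bar>x\<bar> * \<bar>exp x - 1\<bar>" by (metis abs_ge_self abs_mult)
  also have "\<dots> \<le> \<bar>x\<bar> * (\<bar>x\<bar> * exp \<bar>x\<bar>)" using b by (intro mult_left_mono) auto
  finally show ?thesis by (simp add: power2_eq_square mult.assoc)
qed

lemma square_le_exp_abs: "(d * y)\<^sup>2 \<le> 2 * exp (d * \<bar>y\<bar>)" if "d \<ge> 0" for d y :: real
proof -
  have "(d * y)\<^sup>2 / 2 \<le> exp (d * \<bar>y\<bar>) - 1 - d * \<bar>y\<bar>"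
    using exp_lower_Taylor_quadratic[of "d * \<bar>y\<bar>"] that by (simp add: power_mult_distrib)
  moreover have "0 \<le> d * \<bar>y\<bar>" using that by simp
  ultimately show ?thesis by linarith
qed

lemma exp_tilt_le: "exp (s * y + d * \<bar>y\<bar>) \<le> exp ((s + d) * y) + exp ((s - d) * y)" for s d y :: real
  by (cases "0 \<le> y") (auto simp: algebra_simps intro: add_increasing add_increasing2)

text \<open>
  The integrand is squeezed between its linearisation at \<open>s\<close> and the linearisation plus
  \<open>h\<^sup>2 * R\<close>, by convexity and by Taylor's formula. Finite exponential moments a little beyond \<open>s\<close> on
  both sides dominate any polynomial factor, hence make \<open>R\<close> integrable.
\<close>

lemma (in prob_space) mgf_has_real_derivative:
  fixes Y :: "'a \<Rightarrow> real"
  assumes [measurable]: "Y \<in> borel_measurable M"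
    and "d > 0"
    and int: "\<And>u. \<bar>u - s\<bar> \<le> d \<Longrightarrow> integrable M (\<lambda>\<omega>. exp (u * Y \<omega>))"
  shows "((\<lambda>u. expectation (\<lambda>\<omega>. exp (u * Y \<omega>))) has_real_derivative
           expectation (\<lambda>\<omega>. Y \<omega> * exp (s * Y \<omega>))) (at s)"
proof -
  (* One half of the margin d pays for the polynomial factor in R, the other half for the
     displacement h of the exponent. *)
  define e where "e = d / 2"
  have e: "e > 0" "2 * e = d" using \<open>d > 0\<close> by (auto simp: e_def)
  define B where "B = (\<lambda>\<omega>. exp ((s + d) * Y \<omega>) + exp ((s - d) * Y \<omega>))"
  have intB: "integrable M B"
    unfolding B_def using \<open>d > 0\<close> by (intro Bochner_Integration.integrable_add int) auto
  define R where "R = (\<lambda>\<omega>. (Y \<omega>)\<^sup>2 * exp (s * Y \<omega> + e * \<bar>Y \<omega>\<bar>))"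
  have R_le: "R \<omega> \<le> (2 / e\<^sup>2) * B \<omega>" for \<omega>
  proof -
    have "e\<^sup>2 * R \<omega> = (e * Y \<omega>)\<^sup>2 * exp (s * Y \<omega> + e * \<bar>Y \<omega>\<bar>)"
      by (simp add: R_def power_mult_distrib)
    also have "\<dots> \<le> (2 * exp (e * \<bar>Y \<omega>\<bar>)) * exp (s * Y \<omega> + e * \<bar>Y \<omega>\<bar>)"
      using square_le_exp_abs[of e "Y \<omega>"] e by (intro mult_right_mono) auto
    also have "\<dots> = 2 * exp (s * Y \<omega> + d * \<bar>Y \<omega>\<bar>)"
      by (simp add: e(2)[symmetric] exp_add[symmetric] algebra_simps)
    also have "\<dots> \<le> 2 * B \<omega>" unfolding B_def by (intro mult_left_mono exp_tilt_le) simp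
    finally show ?thesis using e by (simp add: field_simps)
  qed
  have intR: "integrable M R"
    by (rule Bochner_Integration.integrable_bound[OF integrable_mult_right[OF intB, of "2 / e\<^sup>2"]])
       (use order_trans[OF R_le abs_ge_self] in \<open>auto simp: R_def intro!: AE_I2\<close>)
  have intD: "integrable M (\<lambda>\<omega>. Y \<omega> * exp (s * Y \<omega>))"
  proof (rule Bochner_Integration.integrable_bound)
    show "integrable M (\<lambda>\<omega>. exp (s * Y \<omega>) + R \<omega>)"
      using int[of s] \<open>d > 0\<close> intR by (intro Bochner_Integration.integrable_add) auto
    show "AE \<omega> in M. norm (Y \<omega> * exp (s * Y \<omega>)) \<le> norm (exp (s * Y \<omega>) + R \<omega>)"
    proof (rule AE_I2)
      fix \<omega>
      have "\<bar>Y \<omega>\<bar> \<le> 1 + (Y \<omega>)\<^sup>2"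
      proof -
        have "0 \<le> (\<bar>Y \<omega>\<bar> - 1)\<^sup>2" by simp
        then show ?thesis
          using zero_le_power2[of "Y \<omega>"] abs_ge_zero[of "Y \<omega>"] by (simp add: power2_diff)
      qed
      then have "\<bar>Y \<omega>\<bar> * exp (s * Y \<omega>) \<le> (1 + (Y \<omega>)\<^sup>2) * exp (s * Y \<omega>)"
        by (intro mult_right_mono) auto
      also have "\<dots> \<le> exp (s * Y \<omega>) + R \<omega>"
        using e by (auto simp: R_def distrib_right intro!: mult_left_mono)
      finally show "norm (Y \<omega> * exp (s * Y \<omega>)) \<le> norm (exp (s * Y \<omega>) + R \<omega>)"
        by (simp add: abs_mult)
    qed
  qed simp
  define m where "m u = expectation (\<lambda>\<omega>. exp (u * Y \<omega>))" for u
  define D where "D = expectation (\<lambda>\<omega>. Y \<omega> * exp (s * Y \<omega>))"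
  have lo: "D * h \<le> m (s + h) - m s" if "\<bar>h\<bar> \<le> e" for h
  proof -
    have "m s + h * D = expectation (\<lambda>\<omega>. exp (s * Y \<omega>) + h * (Y \<omega> * exp (s * Y \<omega>)))"
      unfolding m_def D_def using int[of s] \<open>d > 0\<close> intD by simp
    also have "\<dots> \<le> m (s + h)"
      unfolding m_def
    proof (rule integral_mono)
      fix \<omega>
      have "(1 + h * Y \<omega>) * exp (s * Y \<omega>) \<le> exp (h * Y \<omega>) * exp (s * Y \<omega>)"
        by (intro mult_right_mono) auto
      then show "exp (s * Y \<omega>) + h * (Y \<omega> * exp (s * Y \<omega>)) \<le> exp ((s + h) * Y \<omega>)"
        by (simp add: algebra_simps exp_add)
    qed (use int[of s] int[of "s + h"] intD that e in auto)
    finally show ?thesis by (simp add: algebra_simps)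
  qed
  have hi: "m (s + h) - m s \<le> D * h + expectation R * h\<^sup>2" if "\<bar>h\<bar> \<le> e" for h
  proof -
    have "m (s + h) \<le> expectation (\<lambda>\<omega>. exp (s * Y \<omega>) + h * (Y \<omega> * exp (s * Y \<omega>)) + h\<^sup>2 * R \<omega>)"
      unfolding m_def
    proof (rule integral_mono)
      fix \<omega>
      have "exp (h * Y \<omega>) \<le> 1 + h * Y \<omega> + (h * Y \<omega>)\<^sup>2 * exp \<bar>h * Y \<omega>\<bar>"
        by (rule exp_quadratic_bound)
      also have "\<dots> \<le> 1 + h * Y \<omega> + (h * Y \<omega>)\<^sup>2 * exp (e * \<bar>Y \<omega>\<bar>)"
        using that by (intro add_left_mono mult_left_mono) (auto simp: abs_mult mult_right_mono)
      finally have "exp (h * Y \<omega>) * exp (s * Y \<omega>)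
          \<le> (1 + h * Y \<omega> + (h * Y \<omega>)\<^sup>2 * exp (e * \<bar>Y \<omega>\<bar>)) * exp (s * Y \<omega>)"
        by (intro mult_right_mono) auto
      then show "exp ((s + h) * Y \<omega>)
          \<le> exp (s * Y \<omega>) + h * (Y \<omega> * exp (s * Y \<omega>)) + h\<^sup>2 * R \<omega>"
        by (simp add: R_def algebra_simps exp_add power_mult_distrib)
    qed (use int[of s] int[of "s + h"] intD intR that e in auto)
    also have "\<dots> = m s + h * D + h\<^sup>2 * expectation R"
      unfolding m_def D_def using int[of s] \<open>d > 0\<close> intD intR by simp
    finally show ?thesis by (simp add: algebra_simps)
  qed
  have "((\<lambda>h. (m (s + h) - m s) / h - D) \<longlongrightarrow> 0) (at 0)"
  proof (rule Lim_null_comparison)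
    show "\<forall>\<^sub>F h in at 0. norm ((m (s + h) - m s) / h - D) \<le> expectation R * \<bar>h\<bar>"
      unfolding eventually_at
    proof (intro exI[of _ e] conjI ballI impI)
      fix h :: real
      assume h: "h \<noteq> 0 \<and> dist h 0 < e"
      define r where "r = m (s + h) - m s - D * h"
      have r: "0 \<le> r" "r \<le> expectation R * h\<^sup>2"
        using lo[of h] hi[of h] h by (auto simp: r_def)
      have "(m (s + h) - m s) / h - D = r / h"
        using h by (simp add: r_def field_simps)
      moreover have "\<bar>r / h\<bar> \<le> expectation R * (h\<^sup>2 / \<bar>h\<bar>)"
        using r h by (simp add: abs_divide divide_right_mono)
      moreover have "h\<^sup>2 / \<bar>h\<bar> = \<bar>h\<bar>"
        using h by (simp add: power2_eq_square abs_if)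
      ultimately show "norm ((m (s + h) - m s) / h - D) \<le> expectation R * \<bar>h\<bar>"
        by (simp only: real_norm_def)
    qed (fact e)
    show "((\<lambda>h. expectation R * \<bar>h\<bar>) \<longlongrightarrow> 0) (at 0)"
      by (auto intro!: tendsto_eq_intros)
  qed
  then have "((\<lambda>h. (m (s + h) - m s) / h) \<longlongrightarrow> D) (at 0)"
    by (simp add: Lim_null[symmetric])
  then show ?thesis unfolding DERIV_def m_def D_def .
qed

section \<open>Lower bounds by exponential tilting\<close>

text \<open>
  The mass of the density \<open>exp (s * V)\<close> is split over \<open>V \<le> 0\<close>, the window \<open>0 < V \<le> y\<close>, and \<open>V > y\<close>.
  Moving the tilt down to \<open>s\<^sub>0\<close> bounds the first part, moving it up to \<open>s + h\<close> bounds the last one, and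
  on the window the density is at most its value at the right end.
\<close>

lemma (in prob_space) tilted_mass_inequality:
  fixes V :: "'a \<Rightarrow> real"
  assumes [measurable]: "V \<in> borel_measurable M"
    and "0 \<le> s\<^sub>0" "h \<ge> 0"
  defines "s \<equiv> s\<^sub>0 + h"
  shows "(\<integral>\<^sup>+\<omega>. exp (s * V \<omega>) \<partial>M)
    \<le> (\<integral>\<^sup>+\<omega>. exp (s\<^sub>0 * V \<omega>) \<partial>M)
      + ennreal (exp (s * y)) * emeasure M {\<omega> \<in> space M. V \<omega> > 0}
      + ennreal (exp (- h * y)) * (\<integral>\<^sup>+\<omega>. exp ((s + h) * V \<omega>) \<partial>M)"
proof -
  have "exp (s * v) \<le> exp (s\<^sub>0 * v) + exp (s * y) * indicator {0<..} v + exp (- h * y) * exp ((s + h) * v)" for v :: real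
  proof -
    consider "v \<le> 0" | "0 < v" "v \<le> y" | "y < v" by linarith
    then show ?thesis
    proof cases
      case 1
      then have "s * v \<le> s\<^sub>0 * v" using assms by (intro mult_right_mono_neg) auto
      then show ?thesis using 1 by (simp add: add_increasing2)
    next
      case 2
      then have "s * v \<le> s * y" using assms by (intro mult_left_mono) auto
      then have "exp (s * v) \<le> exp (s * y)" by simp
      also have "\<dots> \<le> exp (s\<^sub>0 * v) + exp (s * y) + exp (- h * y) * exp ((s + h) * v)"
        by (simp add: add_increasing add_increasing2)
      finally show ?thesis using 2 by simp
    next
      case 3
      then have "h * y \<le> h * v" using assms by (intro mult_left_mono) auto
      then have "exp (s * v) \<le> exp (- h * y) * exp ((s + h) * v)"
        by (simp add: exp_add[symmetric] algebra_simps)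
      then show ?thesis by (simp add: add_increasing)
    qed
  qed
  then have "(\<integral>\<^sup>+\<omega>. exp (s * V \<omega>) \<partial>M)
      \<le> (\<integral>\<^sup>+\<omega>. exp (s\<^sub>0 * V \<omega>) + exp (s * y) * indicator {0<..} (V \<omega>)
            + exp (- h * y) * exp ((s + h) * V \<omega>) \<partial>M)"
    by (intro nn_integral_mono ennreal_leI)
  also have "\<dots> = (\<integral>\<^sup>+\<omega>. exp (s\<^sub>0 * V \<omega>) \<partial>M)
      + ennreal (exp (s * y)) * (\<integral>\<^sup>+\<omega>. ennreal (indicator {0<..} (V \<omega>)) \<partial>M)
      + ennreal (exp (- h * y)) * (\<integral>\<^sup>+\<omega>. exp ((s + h) * V \<omega>) \<partial>M)"
    by (simp add: ennreal_plus ennreal_mult nn_integral_add nn_integral_cmult)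
  also have "(\<integral>\<^sup>+\<omega>. ennreal (indicator {0<..} (V \<omega>)) \<partial>M) = (\<integral>\<^sup>+\<omega>. indicator {\<omega> \<in> space M. V \<omega> > 0} \<omega> \<partial>M)"
    by (intro nn_integral_cong) (auto split: split_indicator)
  also have "\<dots> = emeasure M {\<omega> \<in> space M. V \<omega> > 0}" by simp
  finally show ?thesis .
qed

text \<open>
  The tilt is \<open>s = s\<^sub>0 + h\<close> and the window has width \<open>e * t\<close>. The product \<open>s\<^sub>0 * D = 0\<close> is the first-order
  condition for a minimiser over the half-line, with an interior and a boundary case; it is what keeps
  the price \<open>s * e\<close> of the window small although \<open>e\<close> exceeds twice the slope \<open>D\<close>.
\<close>

lemma (in prob_space) exponential_lower_bound_at_minimiser:
  fixes W :: "real \<Rightarrow> 'a \<Rightarrow> real" and L :: "real \<Rightarrow> real"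
  assumes meas: "\<And>t. t > 0 \<Longrightarrow> W t \<in> borel_measurable M"
    and mgf: "\<And>t u. t > 0 \<Longrightarrow> u \<ge> 0 \<Longrightarrow> (\<integral>\<^sup>+\<omega>. exp (u * W t \<omega>) \<partial>M) = ennreal (exp (t * L u))"
    and s0: "s\<^sub>0 \<ge> 0" "\<And>s. s > s\<^sub>0 \<Longrightarrow> L s\<^sub>0 < L s"
    and D: "(L has_real_derivative D) (at s\<^sub>0)" "D \<ge> 0" "s\<^sub>0 * D = 0"
    and a: "a < L s\<^sub>0"
  shows "\<forall>\<^sub>F t in at_top. exp (t * a) \<le> prob {\<omega> \<in> space M. W t \<omega> > 0}"
proof -
  (* The available gap 3 * g is spent in equal parts on s0 * e, on h * e, and on absorbing the
     two tails of the tilted law. *)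
  define g where "g = (L s\<^sub>0 - a) / 3"
  define e where "e = 2 * D + g / (s\<^sub>0 + 1)"
  have g: "g > 0" using a by (simp add: g_def)
  have e: "e > 0" "D < e / 2" using g s0 D by (auto simp: e_def add_nonneg_pos)
  have "((\<lambda>u. L u - e / 2 * u) has_real_derivative (D - e / 2)) (at s\<^sub>0)"
    by (auto intro!: derivative_eq_intros D)
  from DERIV_neg_dec_right[OF this] e obtain d
    where d: "d > 0" "\<And>h. h > 0 \<Longrightarrow> h < d \<Longrightarrow> L (s\<^sub>0 + h) - e / 2 * (s\<^sub>0 + h) < L s\<^sub>0 - e / 2 * s\<^sub>0"
    by auto
  define h where "h = min (d / 4) (g / e)"
  define s where "s = s\<^sub>0 + h"
  have h: "h > 0" "2 * h < d" "h * e \<le> g"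
    using d g e by (auto simp: h_def min_def field_simps)
  (* From s0 to s + h = s0 + 2 * h the exponent grows with a slope below e / 2. *)
  have step: "L (s + h) < L s\<^sub>0 + h * e"
    using d(2)[of "2 * h"] h by (simp add: s_def algebra_simps)
  (* The exponential rates at which the tilted mass to the left and to the right of the window
     vanishes. *)
  define \<alpha> where "\<alpha> = L s - L s\<^sub>0"
  define \<beta> where "\<beta> = L s - L (s + h) + h * e"
  have pos: "\<alpha> > 0" "\<beta> > 0"
    using s0(2)[of s] h(1) step by (auto simp: \<alpha>_def \<beta>_def s_def)
  have cost: "s * e \<le> 2 * g"
  proof -
    have "s\<^sub>0 * e = s\<^sub>0 * g / (s\<^sub>0 + 1)" using D(3) by (simp add: e_def algebra_simps)
    also have "\<dots> \<le> g" using s0(1) g by (simp add: field_simps)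
    finally show ?thesis using h(3) by (simp add: s_def algebra_simps)
  qed
  have decay: "((\<lambda>t. exp (- (x * t))) \<longlongrightarrow> 0) at_top" if "x > 0" for x :: real
    using that by real_asymp
  have "((\<lambda>t. exp (- (\<alpha> * t)) + exp (- (\<beta> * t)) + exp (- (g * t))) \<longlongrightarrow> 0) at_top"
    using tendsto_add[OF tendsto_add[OF decay[OF pos(1)] decay[OF pos(2)]] decay[OF g]]
    by (simp only: add_0_right)
  then have "\<forall>\<^sub>F t in at_top. exp (- (\<alpha> * t)) + exp (- (\<beta> * t)) + exp (- (g * t)) < 1"
    by (rule order_tendstoD) simp
  then show ?thesis
    using eventually_gt_at_top[of 0]
  proof eventually_elim
    case (elim t)
    define p where "p = prob {\<omega> \<in> space M. W t \<omega> > 0}"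
    have [measurable]: "W t \<in> borel_measurable M" using meas elim by simp
    have "ennreal (exp (t * L s)) \<le> ennreal (exp (t * L s\<^sub>0)) + ennreal (exp (s * (e * t))) * ennreal p
        + ennreal (exp (- h * (e * t))) * ennreal (exp (t * L (s + h)))"
      using tilted_mass_inequality[of "W t" s\<^sub>0 h "e * t", folded s_def] elim s0(1) h
        mgf[of t s] mgf[of t "s\<^sub>0"] mgf[of t "s + h"]
      by (simp add: s_def p_def emeasure_eq_measure)
    also have "\<dots> = ennreal (exp (t * L s\<^sub>0) + exp (s * (e * t)) * p + exp (- h * (e * t)) * exp (t * L (s + h)))"
      by (simp add: ennreal_plus ennreal_mult p_def)
    finally have "exp (t * L s) \<le> exp (t * L s\<^sub>0) + exp (s * (e * t)) * p + exp (- h * (e * t)) * exp (t * L (s + h))"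
      by (subst (asm) ennreal_le_iff) (auto simp: p_def intro!: add_nonneg_nonneg)
    then have "exp (- (t * L s)) * exp (t * L s) \<le> exp (- (t * L s)) *
        (exp (t * L s\<^sub>0) + exp (s * (e * t)) * p + exp (- h * (e * t)) * exp (t * L (s + h)))"
      by (rule mult_left_mono) simp
    also have "\<dots> = exp (- (\<alpha> * t)) + exp (t * (s * e - L s)) * p + exp (- (\<beta> * t))"
    proof -
      have "- (t * L s) + t * L s\<^sub>0 = - (\<alpha> * t)" "- (t * L s) + s * (e * t) = t * (s * e - L s)"
        "- (t * L s) + (- h * (e * t) + t * L (s + h)) = - (\<beta> * t)"
        by (simp_all add: \<alpha>_def \<beta>_def algebra_simps)
      then show ?thesis
        by (simp only: distrib_left mult.assoc[of "exp _", symmetric] exp_add[symmetric])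
    qed
    finally have "1 \<le> exp (- (\<alpha> * t)) + exp (t * (s * e - L s)) * p + exp (- (\<beta> * t))"
      by (simp add: exp_minus)
    with elim(1) have "exp (- (g * t)) \<le> exp (t * (s * e - L s)) * p" by linarith
    then have "exp (t * (L s - s * e)) * exp (- (g * t)) \<le> exp (t * (L s - s * e)) * (exp (t * (s * e - L s)) * p)"
      by (rule mult_left_mono) simp
    also have "\<dots> = exp (t * (L s - s * e) + t * (s * e - L s)) * p"
      by (simp only: exp_add mult.assoc)
    also have "t * (L s - s * e) + t * (s * e - L s) = 0" by (simp add: algebra_simps)
    finally have "exp (t * (L s - s * e) + - (g * t)) \<le> p"
      by (simp only: exp_add exp_zero mult_1)
    moreover have "t * (L s - s * e) + - (g * t) = t * (L s - s * e - g)"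
      by (simp add: algebra_simps)
    ultimately have le: "exp (t * (L s - s * e - g)) \<le> p" by simp
    have "L s\<^sub>0 - a = 3 * g" by (simp add: g_def)
    then have "a \<le> L s - s * e - g" using cost pos(1) unfolding \<alpha>_def by linarith
    then have "exp (t * a) \<le> exp (t * (L s - s * e - g))" using elim by simp
    with le have "exp (t * a) \<le> p" by (rule order_trans[rotated])
    then show ?case by (simp only: p_def)
  qed
qed

text \<open>
  The tilting argument needs \<open>L\<close> to be strictly larger to the right of the minimiser, whereas \<open>L\<close>
  may be flat at its minimum; hence the largest one.
\<close>

lemma ex_largest_minimiser:
  fixes L :: "real \<Rightarrow> real"
  assumes cont: "continuous_on {0..} L" and lim: "filterlim L at_top at_top"
  obtains s\<^sub>0 where "s\<^sub>0 \<ge> 0" "\<And>s. s \<ge> 0 \<Longrightarrow> L s\<^sub>0 \<le> L s" "\<And>s. s > s\<^sub>0 \<Longrightarrow> L s\<^sub>0 < L s"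
proof -
  obtain R where R: "\<And>s. s \<ge> R \<Longrightarrow> L s > L 0"
    using lim by (auto simp: filterlim_at_top_dense eventually_at_top_linorder)
  define Q where "Q = max R 0"
  have contQ: "continuous_on {0..Q} L" by (rule continuous_on_subset[OF cont]) auto
  obtain z where z: "z \<in> {0..Q}" "\<And>s. s \<in> {0..Q} \<Longrightarrow> L z \<le> L s"
    using continuous_attains_inf[OF _ _ contQ] by (auto simp: Q_def)
  have min: "L z \<le> L s" if "s \<ge> 0" for s
  proof (cases "s \<le> Q")
    case True
    then show ?thesis using z(2) that by simp
  next
    case False
    then have "L 0 < L s" using R[of s] by (simp add: Q_def)
    moreover have "L z \<le> L 0" using z(2)[of 0] by (simp add: Q_def)
    ultimately show ?thesis by simp
  qed
  define T where "T = {0..Q} \<inter> L -` {..L z}"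
  have "compact T"
    unfolding T_def compact_eq_bounded_closed
    using continuous_closed_preimage[OF contQ closed_atLeastAtMost closed_atMost]
    by (auto intro: bounded_subset[of "{0..Q}"])
  moreover have "z \<in> T" using z(1) by (simp add: T_def)
  ultimately obtain s\<^sub>0 where s0: "s\<^sub>0 \<in> T" "\<And>s. s \<in> T \<Longrightarrow> s \<le> s\<^sub>0"
    using compact_attains_sup[of T] by blast
  show ?thesis
  proof
    show "s\<^sub>0 \<ge> 0" using s0(1) by (simp add: T_def)
    show le: "L s\<^sub>0 \<le> L s" if "s \<ge> 0" for s
      using s0(1) min[OF that] by (simp add: T_def)
    show "L s\<^sub>0 < L s" if "s > s\<^sub>0" for s
    proof (rule ccontr)
      assume "\<not> L s\<^sub>0 < L s"
      then have "L s \<le> L z" using s0(1) by (simp add: T_def)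
      moreover have "s \<ge> 0" using s0(1) that by (simp add: T_def)
      moreover have "s \<le> Q"
      proof (rule ccontr)
        assume "\<not> s \<le> Q"
        then have "L 0 < L s" using R[of s] by (simp add: Q_def)
        with \<open>L s \<le> L z\<close> min[of 0] show False by simp
      qed
      ultimately have "s \<in> T" by (simp add: T_def)
      then show False using s0(2) that by force
    qed
  qed
qed

lemma (in prob_space) exponential_lower_bound:
  fixes W :: "real \<Rightarrow> 'a \<Rightarrow> real" and L :: "real \<Rightarrow> real"
  assumes meas: "\<And>t. t > 0 \<Longrightarrow> W t \<in> borel_measurable M"
    and mgf: "\<And>t u. t > 0 \<Longrightarrow> u \<ge> 0 \<Longrightarrow> (\<integral>\<^sup>+\<omega>. exp (u * W t \<omega>) \<partial>M) = ennreal (exp (t * L u))"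
    and diff: "\<And>s. s \<ge> 0 \<Longrightarrow> L differentiable (at s)"
    and lim: "filterlim L at_top at_top"
    and a: "\<And>s. s \<ge> 0 \<Longrightarrow> a < L s"
  shows "\<forall>\<^sub>F t in at_top. exp (t * a) \<le> prob {\<omega> \<in> space M. W t \<omega> > 0}"
proof -
  have "continuous_on {0..} L"
    by (intro continuous_at_imp_continuous_on ballI differentiable_imp_continuous_within diff) simp
  then obtain s\<^sub>0 where s0: "s\<^sub>0 \<ge> 0" "\<And>s. s \<ge> 0 \<Longrightarrow> L s\<^sub>0 \<le> L s" "\<And>s. s > s\<^sub>0 \<Longrightarrow> L s\<^sub>0 < L s"
    using ex_largest_minimiser[OF _ lim] by metis
  obtain D where D: "(L has_real_derivative D) (at s\<^sub>0)"
    using diff[OF s0(1)] real_differentiable_def by blast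
  have "D \<ge> 0"
  proof (rule ccontr)
    assume "\<not> D \<ge> 0"
    then obtain d where "d > 0" "\<And>h. h > 0 \<Longrightarrow> h < d \<Longrightarrow> L s\<^sub>0 > L (s\<^sub>0 + h)"
      using DERIV_neg_dec_right[OF D] by auto
    from this(2)[of "d / 2"] this(1) s0(3)[of "s\<^sub>0 + d / 2"] show False by simp
  qed
  moreover have "s\<^sub>0 * D = 0"
  proof (cases "s\<^sub>0 = 0")
    case False
    then have "D = 0" using s0 by (intro DERIV_local_min[OF D, of s\<^sub>0]) auto
    then show ?thesis by simp
  qed simp
  ultimately show ?thesis
    using a[OF s0(1)] s0 D meas mgf
    by (intro exponential_lower_bound_at_minimiser[where D = D and L = L and s\<^sub>0 = s\<^sub>0]) simp_all
qed

section \<open>Exponential moments of compound Poisson sums\<close>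

text \<open>
  The independence hypothesis speaks of whole processes; this turns it into the independence of
  particular functions of them.
\<close>

lemma (in prob_space) indep_vars_if_indep_subalgebras:
  assumes "indep_sets (\<lambda>j. sets (F j)) J"
    and "\<And>j. j \<in> J \<Longrightarrow> space (F j) = space M"
    and "\<And>j. j \<in> J \<Longrightarrow> f j \<in> measurable (F j) (M' j)"
  shows "indep_vars M' f J"
  unfolding indep_vars_def2
proof (intro conjI ballI)
  have sub: "sets (F j) \<subseteq> events" if "j \<in> J" for j
    using assms(1) that by (auto simp: indep_sets_def)
  fix j assume j: "j \<in> J"
  show "random_variable (M' j) (f j)"
    using measurable_mono[of "M' j" "M' j" "F j" M] assms(2,3)[OF j] sub[OF j] by auto
next
  show "indep_sets (\<lambda>j. {f j -` A \<inter> space M |A. A \<in> sets (M' j)}) J"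
  proof (rule indep_sets_mono_sets[OF assms(1)])
    fix j assume j: "j \<in> J"
    show "{f j -` A \<inter> space M |A. A \<in> sets (M' j)} \<subseteq> sets (F j)"
      using measurable_sets[OF assms(3)[OF j]] assms(2)[OF j] by auto
  qed
qed

lemma measurable_process_component:
  assumes "t \<in> T" and "space S = UNIV"
  shows "Y t \<in> measurable (vimage_algebra A (\<lambda>\<omega>. \<lambda>t\<in>T. Y t \<omega>) (PiM T (\<lambda>_. S))) S"
proof -
  have "(\<lambda>\<omega>. (\<lambda>t\<in>T. Y t \<omega>) t) \<in> measurable (vimage_algebra A (\<lambda>\<omega>. \<lambda>t\<in>T. Y t \<omega>) (PiM T (\<lambda>_. S))) S"
    by (rule measurable_compose[OF measurable_vimage_algebra1 measurable_component_singleton])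
       (use assms in \<open>auto simp: space_PiM\<close>)
  then show ?thesis using assms by simp
qed

lemma poisson_generating_function:
  assumes "r > 0" "m \<ge> 0"
  shows "(\<Sum>n. ennreal (pmf (poisson_pmf r) n) * ennreal m ^ n) = ennreal (exp (r * (m - 1)))"
proof -
  have "(\<lambda>n. exp (- r) * ((r * m) ^ n / fact n)) sums (exp (- r) * exp (r * m))"
    using exp_converges[of "r * m"] by (intro sums_mult) (simp add: divide_inverse mult.commute)
  then have "(\<lambda>n. pmf (poisson_pmf r) n * m ^ n) sums exp (r * (m - 1))"
    using assms by (simp add: exp_add[symmetric] power_mult_distrib algebra_simps)
  then have "(\<Sum>n. ennreal (pmf (poisson_pmf r) n * m ^ n)) = ennreal (exp (r * (m - 1)))"
    using assms by (intro suminf_ennreal_eq) auto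
  moreover have "ennreal (pmf (poisson_pmf r) n * m ^ n) = ennreal (pmf (poisson_pmf r) n) * ennreal m ^ n" for n
    using assms(2) by (simp add: ennreal_mult ennreal_power del: pmf_poisson)
  ultimately show ?thesis by simp
qed

text \<open>
  Conditionally on \<open>K = n\<close> the product has mean \<open>m ^ n\<close>, so its mean is the generating function of the
  Poisson law at \<open>m\<close>. Working with nonnegative extended reals, the sum over \<open>n\<close> may be exchanged
  with the integral.
\<close>

lemma (in prob_space) compound_poisson_product:
  fixes K :: "'a \<Rightarrow> nat" and Z :: "nat \<Rightarrow> 'a \<Rightarrow> ennreal"
  assumes K: "distr M (count_space UNIV) K = measure_pmf (poisson_pmf r)" "r > 0"
    and K_meas: "K \<in> measurable F (count_space UNIV)"
    and Z_meas: "\<And>k. k \<ge> 1 \<Longrightarrow> Z k \<in> borel_measurable G"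
    and space: "space F = space M" "space G = space M"
    and indep: "indep_set (sets F) (sets G)"
    and Z_indep: "indep_vars (\<lambda>_. borel) Z {1..}"
    and Z_mean: "\<And>k. k \<ge> 1 \<Longrightarrow> (\<integral>\<^sup>+\<omega>. Z k \<omega> \<partial>M) = ennreal m" "m \<ge> 0"
  shows "(\<integral>\<^sup>+\<omega>. (\<Prod>k = 1..K \<omega>. Z k \<omega>) \<partial>M) = ennreal (exp (r * (m - 1)))"
proof -
  have sub: "sets F \<subseteq> events" "sets G \<subseteq> events"
    using indep by (auto simp: indep_set_def indep_sets_def UNIV_bool)
  have [measurable]: "K \<in> measurable M (count_space UNIV)"
    using K_meas sub space measurable_mono[of "count_space UNIV" "count_space UNIV" F M] by auto
  have Z_M: "Z k \<in> borel_measurable M" if "k \<ge> 1" for k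
    using Z_meas[OF that] sub space measurable_mono[of borel borel G M] by auto
  have summand: "(\<integral>\<^sup>+\<omega>. indicator {n} (K \<omega>) * (\<Prod>k = 1..n. Z k \<omega>) \<partial>M)
      = ennreal (pmf (poisson_pmf r) n) * ennreal m ^ n" for n
  proof -
    define f where "f = case_bool (\<lambda>\<omega>. indicator {n} (K \<omega>)) (\<lambda>\<omega>. \<Prod>k = 1..n. Z k \<omega>)"
    have "indep_vars (\<lambda>_. borel :: ennreal measure) f UNIV"
    proof (rule indep_vars_if_indep_subalgebras[where F = "case_bool F G"])
      show "indep_sets (\<lambda>j. sets (case_bool F G j)) UNIV"
        using indep unfolding indep_set_def by (rule indep_sets_mono_sets) (auto split: bool.split)
      show "f j \<in> borel_measurable (case_bool F G j)" for j
        using measurable_compose[OF K_meas, of "indicator {n}" borel] Z_meas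
        by (cases j) (auto simp: f_def)
    qed (auto split: bool.split simp: space)
    then have "(\<integral>\<^sup>+\<omega>. (\<Prod>j\<in>UNIV. f j \<omega>) \<partial>M) = (\<Prod>j\<in>UNIV. \<integral>\<^sup>+\<omega>. f j \<omega> \<partial>M)"
      by (intro indep_vars_nn_integral) auto
    then have "(\<integral>\<^sup>+\<omega>. indicator {n} (K \<omega>) * (\<Prod>k = 1..n. Z k \<omega>) \<partial>M)
        = (\<integral>\<^sup>+\<omega>. indicator {n} (K \<omega>) \<partial>M) * (\<integral>\<^sup>+\<omega>. (\<Prod>k = 1..n. Z k \<omega>) \<partial>M)"
      by (simp add: f_def UNIV_bool mult.commute)
    also have "(\<integral>\<^sup>+\<omega>. indicator {n} (K \<omega>) \<partial>M) = (\<integral>\<^sup>+j. indicator {n} j \<partial>distr M (count_space UNIV) K)"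
      by (subst nn_integral_distr) auto
    also have "\<dots> = ennreal (pmf (poisson_pmf r) n)"
      by (simp add: K emeasure_pmf_single)
    also have "(\<integral>\<^sup>+\<omega>. (\<Prod>k = 1..n. Z k \<omega>) \<partial>M) = (\<Prod>k = 1..n. \<integral>\<^sup>+\<omega>. Z k \<omega> \<partial>M)"
      by (intro indep_vars_nn_integral indep_vars_subset[OF Z_indep]) auto
    also have "\<dots> = ennreal m ^ n" using Z_mean by simp
    finally show ?thesis .
  qed
  have "(\<integral>\<^sup>+\<omega>. (\<Prod>k = 1..K \<omega>. Z k \<omega>) \<partial>M)
      = (\<integral>\<^sup>+\<omega>. (\<Sum>n. indicator {n} (K \<omega>) * (\<Prod>k = 1..n. Z k \<omega>)) \<partial>M)"
  proof (rule nn_integral_cong)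
    fix \<omega>
    have "(\<Sum>n. indicator {n} (K \<omega>) * (\<Prod>k = 1..n. Z k \<omega>))
        = (\<Sum>n\<in>{K \<omega>}. indicator {n} (K \<omega>) * (\<Prod>k = 1..n. Z k \<omega>))"
      by (rule suminf_finite) auto
    then show "(\<Prod>k = 1..K \<omega>. Z k \<omega>) = (\<Sum>n. indicator {n} (K \<omega>) * (\<Prod>k = 1..n. Z k \<omega>))"
      by simp
  qed
  also have "\<dots> = (\<Sum>n. \<integral>\<^sup>+\<omega>. indicator {n} (K \<omega>) * (\<Prod>k = 1..n. Z k \<omega>) \<partial>M)"
  proof (rule nn_integral_suminf)
    fix n
    have [measurable]: "(\<lambda>\<omega>. indicator {n} (K \<omega>) :: ennreal) \<in> borel_measurable M"
      by (rule measurable_compose[of K M "count_space UNIV"]) auto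
    have [measurable]: "(\<lambda>\<omega>. \<Prod>k = 1..n. Z k \<omega>) \<in> borel_measurable M"
      by (intro borel_measurable_prod_ennreal Z_M) auto
    show "(\<lambda>\<omega>. indicator {n} (K \<omega>) * (\<Prod>k = 1..n. Z k \<omega>)) \<in> borel_measurable M"
      by measurable
  qed
  also have "\<dots> = (\<Sum>n. ennreal (pmf (poisson_pmf r) n) * ennreal m ^ n)"
    by (simp only: summand)
  also have "\<dots> = ennreal (exp (r * (m - 1)))"
    using K(2) Z_mean(2) by (rule poisson_generating_function)
  finally show ?thesis .
qed

locale compound_poisson_streams = prob_space P
  for P :: "'a measure" +
  fixes I :: nat and rate :: "nat \<Rightarrow> real"
    and N :: "nat \<Rightarrow> real \<Rightarrow> 'a \<Rightarrow> nat" and X :: "nat \<Rightarrow> nat \<Rightarrow> 'a \<Rightarrow> real"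
  assumes rate_pos: "i \<in> {1..I} \<Longrightarrow> rate i > 0"
    and poisson: "i \<in> {1..I} \<Longrightarrow> poisson_process P (rate i) (N i)"
    and iid: "i \<in> {1..I} \<Longrightarrow> iid_real P (X i) {1..}"
    and indep: "indep_sets
           (case_sum
              (\<lambda>i. process_events P (count_space UNIV) {0..} (N i))
              (\<lambda>i. process_events P borel {1..} (X i)))
           ({1..I} <+> {1..I})"
begin

text \<open>
  The jumps are passed through a function \<open>g\<close>, so that the same results apply to the original jumps
  and to truncated ones.
\<close>

definition total :: "(real \<Rightarrow> real) \<Rightarrow> real \<Rightarrow> 'a \<Rightarrow> real" where
  "total g t \<omega> = (\<Sum>i = 1..I. \<Sum>k = 1..N i t \<omega>. g (X i k \<omega>))"

definition count_algebra :: "nat \<Rightarrow> 'a measure" where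
  "count_algebra i = vimage_algebra (space P) (\<lambda>\<omega>. \<lambda>t\<in>{0..}. N i t \<omega>) (PiM {0..} (\<lambda>_. count_space UNIV))"

definition jump_algebra :: "nat \<Rightarrow> 'a measure" where
  "jump_algebra i = vimage_algebra (space P) (\<lambda>\<omega>. \<lambda>k\<in>{1..}. X i k \<omega>) (PiM {1..} (\<lambda>_. borel))"

lemma indep_algebras:
  "indep_sets (case_sum (\<lambda>i. sets (count_algebra i)) (\<lambda>i. sets (jump_algebra i))) ({1..I} <+> {1..I})"
  using indep unfolding process_events_def count_algebra_def jump_algebra_def .

lemma space_algebras [simp]: "space (count_algebra i) = space P" "space (jump_algebra i) = space P"
  by (simp_all add: count_algebra_def jump_algebra_def)

lemma sets_algebras:
  assumes "i \<in> {1..I}"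
  shows "sets (count_algebra i) \<subseteq> events" "sets (jump_algebra i) \<subseteq> events"
proof -
  have "case_sum (\<lambda>i. sets (count_algebra i)) (\<lambda>i. sets (jump_algebra i)) j \<subseteq> events"
    if "j \<in> {1..I} <+> {1..I}" for j
    using indep_algebras that unfolding indep_sets_def by blast
  from this[of "Inl i"] this[of "Inr i"]
  show "sets (count_algebra i) \<subseteq> events" "sets (jump_algebra i) \<subseteq> events"
    using InlI[OF assms, of "{1..I}"] InrI[OF assms, of "{1..I}"] by (simp_all del: One_nat_def)
qed

lemma indep_count_jump:
  assumes i: "i \<in> {1..I}"
  shows "indep_set (sets (count_algebra i)) (sets (jump_algebra i))"
proof (rule indep_setI)
  fix a b assume ab: "a \<in> sets (count_algebra i)" "b \<in> sets (jump_algebra i)"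
  have "prob (\<Inter>j\<in>{Inl i, Inr i}. case_sum (\<lambda>_. a) (\<lambda>_. b) j)
      = (\<Prod>j\<in>{Inl i, Inr i}. prob (case_sum (\<lambda>_. a) (\<lambda>_. b) j))"
    by (rule indep_setsD[OF indep_algebras]) (use ab i in auto)
  then show "prob (a \<inter> b) = prob a * prob b" by simp
qed (use sets_algebras[OF i] in auto)

lemma count_measurable:
  "t \<ge> 0 \<Longrightarrow> N i t \<in> measurable (count_algebra i) (count_space UNIV)"
  unfolding count_algebra_def by (rule measurable_process_component) auto

lemma jump_measurable:
  "k \<ge> 1 \<Longrightarrow> X i k \<in> borel_measurable (jump_algebra i)"
  unfolding jump_algebra_def by (rule measurable_process_component) auto

lemma jump_random_variable:
  assumes "i \<in> {1..I}" "k \<ge> 1"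
  shows "X i k \<in> borel_measurable P"
  using iid[OF assms(1)] assms(2) by (auto simp: iid_real_def indep_vars_def)

text \<open>
  The count and the jumps of one stream together; distinct streams generate independent such algebras.
\<close>

definition stream_algebra :: "nat \<Rightarrow> 'a measure" where
  "stream_algebra i = sigma (space P) (sets (count_algebra i) \<union> sets (jump_algebra i))"

lemma space_stream_algebra [simp]: "space (stream_algebra i) = space P"
  unfolding stream_algebra_def by (simp add: space_measure_of_conv)

lemma sets_stream_algebra:
  "sets (stream_algebra i) = sigma_sets (space P) (sets (count_algebra i) \<union> sets (jump_algebra i))"
  unfolding stream_algebra_def
  using sets.space_closed[of "count_algebra i"] sets.space_closed[of "jump_algebra i"]
  by (intro sets_measure_of) auto

lemma indep_streams: "indep_sets (\<lambda>i. sets (stream_algebra i)) {1..I}"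
proof -
  let ?E = "case_sum (\<lambda>i. sets (count_algebra i)) (\<lambda>i. sets (jump_algebra i))"
  have "indep_sets (\<lambda>i. sigma_sets (space P) (\<Union>j\<in>{Inl i, Inr i}. ?E j)) {1..I}"
  proof (rule indep_sets_collect_sigma)
    have "(\<Union>i\<in>{1..I}. {Inl i, Inr i}) = {1..I} <+> {1..I}" by auto
    then show "indep_sets ?E (\<Union>i\<in>{1..I}. {Inl i, Inr i})" using indep_algebras by simp
    show "Int_stable (?E j)" for j by (cases j) (auto simp: sets.Int_stable)
  qed (auto simp: disjoint_family_on_def)
  then show ?thesis by (simp add: sets_stream_algebra)
qed

lemma stream_measurableI:
  assumes "f \<in> measurable (count_algebra i) M \<or> f \<in> measurable (jump_algebra i) M"
  shows "f \<in> measurable (stream_algebra i) M"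
proof -
  have "sets (count_algebra i) \<subseteq> sets (stream_algebra i)" "sets (jump_algebra i) \<subseteq> sets (stream_algebra i)"
    unfolding sets_stream_algebra by auto
  then show ?thesis
    using assms measurable_mono[of M M "count_algebra i" "stream_algebra i"]
      measurable_mono[of M M "jump_algebra i" "stream_algebra i"] by auto
qed

lemma stream_product_measurable:
  assumes "t \<ge> 0" "\<And>k. k \<ge> 1 \<Longrightarrow> Z k \<in> borel_measurable (jump_algebra i)"
  shows "(\<lambda>\<omega>. \<Prod>k = 1..N i t \<omega>. Z k \<omega> :: ennreal) \<in> borel_measurable (stream_algebra i)"
proof (rule measurable_compose_countable[rotated])
  show "N i t \<in> measurable (stream_algebra i) (count_space UNIV)"
    by (rule stream_measurableI[OF disjI1[OF count_measurable[OF assms(1)]]])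
  show "(\<lambda>\<omega>. \<Prod>k = 1..n. Z k \<omega>) \<in> borel_measurable (stream_algebra i)" for n
    by (rule borel_measurable_prod_ennreal, rule stream_measurableI, rule disjI2, rule assms(2)) simp
qed

text \<open>
  The count at time \<open>t\<close> is the increment from time \<open>0\<close>, where the process starts at \<open>0\<close>.
\<close>

lemma count_distr:
  assumes "i \<in> {1..I}" "t > 0"
  shows "distr P (count_space UNIV) (N i t) = measure_pmf (poisson_pmf (rate i * t))"
proof -
  note pp = poisson[OF assms(1), unfolded poisson_process_def]
  have "distr P (count_space UNIV) (\<lambda>\<omega>. N i t \<omega> - N i 0 \<omega>) = measure_pmf (poisson_pmf (rate i * (t - 0)))"
    using pp assms(2) by blast
  moreover have "distr P (count_space UNIV) (\<lambda>\<omega>. N i t \<omega> - N i 0 \<omega>) = distr P (count_space UNIV) (N i t)"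
  proof (rule distr_cong)
    fix \<omega> assume "\<omega> \<in> space P"
    then have "N i 0 \<omega> = 0" using pp by blast
    then show "N i t \<omega> - N i 0 \<omega> = N i t \<omega>" by simp
  qed simp_all
  ultimately show ?thesis by simp
qed

lemma jump_nn_integral:
  assumes "i \<in> {1..I}" "k \<ge> 1" "f \<in> borel_measurable borel"
  shows "(\<integral>\<^sup>+\<omega>. f (X i k \<omega>) \<partial>P) = (\<integral>\<^sup>+\<omega>. f (X i 1 \<omega>) \<partial>P)"
proof -
  have eq: "distr P borel (X i k) = distr P borel (X i 1)"
    using iid[OF assms(1)] assms(2) unfolding iid_real_def by (metis atLeast_iff order_refl)
  have law: "(\<integral>\<^sup>+x. f x \<partial>distr P borel (X i l)) = (\<integral>\<^sup>+\<omega>. f (X i l \<omega>) \<partial>P)" if "l \<ge> 1" for l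
    by (rule nn_integral_distr[OF jump_random_variable[OF assms(1) that]]) (use assms(3) in simp)
  show ?thesis unfolding law[OF assms(2), symmetric] law[OF order_refl, symmetric] eq ..
qed

lemma total_measurable:
  assumes "t \<ge> 0" and [measurable]: "g \<in> borel_measurable borel"
  shows "total g t \<in> borel_measurable P"
  unfolding total_def[abs_def]
proof (rule borel_measurable_sum)
  fix i assume i: "i \<in> {1..I}"
  have "N i t \<in> measurable P (count_space UNIV)"
    using poisson[OF i] assms(1) by (simp add: poisson_process_def)
  then show "(\<lambda>\<omega>. \<Sum>k = 1..N i t \<omega>. g (X i k \<omega>)) \<in> borel_measurable P"
  proof (rule measurable_compose_countable[rotated])
    show "(\<lambda>\<omega>. \<Sum>k = 1..n. g (X i k \<omega>)) \<in> borel_measurable P" for n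
      using jump_random_variable[OF i]
      by (intro borel_measurable_sum measurable_compose[OF _ assms(2)]) auto
  qed
qed

text \<open>
  The exponential of the aggregate is a product over the streams of products over their jumps.
  Independence of the streams separates the outer product, and each factor is a compound Poisson
  product.
\<close>

theorem mgf_total:
  assumes t: "t > 0" and g [measurable]: "g \<in> borel_measurable borel"
    and m: "\<And>i. i \<in> {1..I} \<Longrightarrow> (\<integral>\<^sup>+\<omega>. exp (s * g (X i 1 \<omega>)) \<partial>P) = ennreal (m i)"
      "\<And>i. i \<in> {1..I} \<Longrightarrow> m i \<ge> 0"
  shows "(\<integral>\<^sup>+\<omega>. exp (s * total g t \<omega>) \<partial>P) = ennreal (exp (t * (\<Sum>i = 1..I. rate i * (m i - 1))))"
proof -
  define Z where "Z i k \<omega> = ennreal (exp (s * g (X i k \<omega>)))" for i k \<omega>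
  have Z_jump: "Z i k \<in> borel_measurable (jump_algebra i)" if "k \<ge> 1" for i k
    using measurable_compose[OF jump_measurable[OF that, of i], of "\<lambda>x. ennreal (exp (s * g x))" borel]
    by (simp add: Z_def[abs_def])
  define W where "W i \<omega> = (\<Prod>k = 1..N i t \<omega>. Z i k \<omega>)" for i \<omega>
  have W: "(\<integral>\<^sup>+\<omega>. W i \<omega> \<partial>P) = ennreal (exp (rate i * t * (m i - 1)))" if i: "i \<in> {1..I}" for i
    unfolding W_def
  proof (rule compound_poisson_product[where F = "count_algebra i" and G = "jump_algebra i"])
    have "indep_vars (\<lambda>_. borel) (X i) {1..}" using iid[OF i] by (simp add: iid_real_def)
    from indep_vars_compose2[OF this, of "\<lambda>_ x. ennreal (exp (s * g x))" "\<lambda>_. borel"]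
    show "indep_vars (\<lambda>_. borel) (Z i) {1..}" by (simp add: Z_def[abs_def])
    show "(\<integral>\<^sup>+\<omega>. Z i k \<omega> \<partial>P) = ennreal (m i)" if "k \<ge> 1" for k
      unfolding Z_def m(1)[OF i, symmetric] by (rule jump_nn_integral[OF i that]) measurable
    show "distr P (count_space UNIV) (N i t) = measure_pmf (poisson_pmf (rate i * t))"
      using i t by (rule count_distr)
    show "rate i * t > 0" using rate_pos[OF i] t by simp
    show "N i t \<in> measurable (count_algebra i) (count_space UNIV)"
      using t by (intro count_measurable) simp
  qed (rule Z_jump space_algebras indep_count_jump i m(2) | assumption)+
  have "indep_vars (\<lambda>_. borel) W {1..I}"
  proof (rule indep_vars_if_indep_subalgebras[OF indep_streams])
    show "W i \<in> borel_measurable (stream_algebra i)" for i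
      unfolding W_def[abs_def] by (rule stream_product_measurable[OF less_imp_le[OF t] Z_jump])
  qed simp
  then have "(\<integral>\<^sup>+\<omega>. (\<Prod>i = 1..I. W i \<omega>) \<partial>P) = (\<Prod>i = 1..I. \<integral>\<^sup>+\<omega>. W i \<omega> \<partial>P)"
    by (intro indep_vars_nn_integral) auto
  also have "\<dots> = (\<Prod>i = 1..I. ennreal (exp (rate i * t * (m i - 1))))"
    by (intro prod.cong W) auto
  also have "\<dots> = ennreal (exp (\<Sum>i = 1..I. rate i * t * (m i - 1)))"
    by (subst prod_ennreal) (simp_all add: exp_sum)
  also have "(\<Sum>i = 1..I. rate i * t * (m i - 1)) = t * (\<Sum>i = 1..I. rate i * (m i - 1))"
    unfolding sum_distrib_left by (intro sum.cong refl) (simp only: mult_ac)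
  also have "(\<lambda>\<omega>. \<Prod>i = 1..I. W i \<omega>) = (\<lambda>\<omega>. ennreal (exp (s * total g t \<omega>)))"
  proof
    fix \<omega>
    have "(\<Prod>i = 1..I. W i \<omega>) = (\<Prod>i = 1..I. ennreal (\<Prod>k = 1..N i t \<omega>. exp (s * g (X i k \<omega>))))"
      unfolding W_def Z_def by (intro prod.cong refl prod_ennreal) simp
    also have "\<dots> = ennreal (\<Prod>i = 1..I. \<Prod>k = 1..N i t \<omega>. exp (s * g (X i k \<omega>)))"
      by (intro prod_ennreal prod_nonneg) simp
    also have "\<dots> = ennreal (exp (s * total g t \<omega>))"
      unfolding total_def sum_distrib_left by (simp only: exp_sum finite_atLeastAtMost)
    finally show "(\<Prod>i = 1..I. W i \<omega>) = ennreal (exp (s * total g t \<omega>))" .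
  qed
  finally show ?thesis .
qed

end

section \<open>Truncated jumps and their exponents\<close>

(* Keeps the index 1 of the first jump of a stream in the form in which the hypotheses mention it. *)
declare One_nat_def [simp del]

text \<open>
  For \<open>c < 0\<close> the linear part alone tends to infinity. Otherwise \<open>Y\<close> is positive with positive
  probability, and \<open>exp x \<ge> x\<^sup>2 / 2\<close> for \<open>x \<ge> 0\<close> makes the exponential moment grow at least
  quadratically in \<open>s\<close>.
\<close>

lemma (in prob_space) compensated_mgf_at_top:
  fixes Y :: "'a \<Rightarrow> real"
  assumes [measurable]: "Y \<in> borel_measurable M"
    and int: "\<And>s. s \<ge> 0 \<Longrightarrow> integrable M (\<lambda>\<omega>. exp (s * Y \<omega>))"
    and r: "r > 0"
    and pos: "c < 0 \<or> prob {\<omega> \<in> space M. Y \<omega> > 0} > 0"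
  shows "filterlim (\<lambda>s. r * (expectation (\<lambda>\<omega>. exp (s * Y \<omega>)) - 1) - c * s) at_top at_top"
proof (cases "c < 0")
  case True
  have "filterlim (\<lambda>s. r * (0 - 1) - c * s) at_top at_top"
    using True by real_asymp
  then show ?thesis
  proof (rule filterlim_at_top_mono)
    have "r * (0 - 1) - c * s \<le> r * (expectation (\<lambda>\<omega>. exp (s * Y \<omega>)) - 1) - c * s" for s
      using r by (intro diff_right_mono mult_left_mono) auto
    then show "\<forall>\<^sub>F s in at_top. r * (0 - 1) - c * s \<le> r * (expectation (\<lambda>\<omega>. exp (s * Y \<omega>)) - 1) - c * s"
      by (rule always_eventually[OF allI])
  qed
next
  case False
  define V where "V \<omega> = (max 0 (Y \<omega>))\<^sup>2 / 2" for \<omega>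
  have V_le: "s\<^sup>2 * V \<omega> \<le> exp (s * Y \<omega>)" if "s \<ge> 0" for s \<omega>
  proof (cases "Y \<omega> \<ge> 0")
    case True
    then have "0 \<le> s * Y \<omega>" using that by simp
    from exp_lower_Taylor_quadratic[OF this] this
    have "(s * Y \<omega>)\<^sup>2 / 2 \<le> exp (s * Y \<omega>)" by linarith
    then show ?thesis using True by (simp add: V_def power_mult_distrib)
  qed (simp add: V_def)
  have V_meas [measurable]: "V \<in> borel_measurable M" unfolding V_def[abs_def] by measurable
  have V_nonneg: "0 \<le> V \<omega>" for \<omega> by (simp add: V_def)
  have V_int: "integrable M V"
    by (rule Bochner_Integration.integrable_bound[OF int[of 1]]) (use V_le[of 1] V_nonneg in auto)
  have "expectation V \<noteq> 0"
  proof
    assume "expectation V = 0"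
    then have "AE \<omega> in M. V \<omega> = 0"
      using V_int V_nonneg by (subst (asm) integral_nonneg_eq_0_iff_AE) auto
    then have "AE \<omega> in M. \<not> Y \<omega> > 0"
      by eventually_elim (auto simp: V_def)
    then have "prob {\<omega> \<in> space M. Y \<omega> > 0} = 0"
      by (subst (asm) AE_iff_measurable[OF _ refl]) (auto simp: emeasure_eq_measure)
    with pos False show False by simp
  qed
  then have q: "expectation V > 0"
    using V_nonneg by (simp add: less_le)
  have "filterlim (\<lambda>s. r * (s\<^sup>2 * q - 1) - c * s) at_top at_top" if "q > 0" for q
    using r that by real_asymp
  note this[OF q]
  then show ?thesis
  proof (rule filterlim_at_top_mono)
    show "\<forall>\<^sub>F s in at_top. r * (s\<^sup>2 * expectation V - 1) - c * s
        \<le> r * (expectation (\<lambda>\<omega>. exp (s * Y \<omega>)) - 1) - c * s"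
      using eventually_ge_at_top[of 0]
    proof eventually_elim
      case (elim s)
      have "s\<^sup>2 * expectation V = expectation (\<lambda>\<omega>. s\<^sup>2 * V \<omega>)" by simp
      also have "\<dots> \<le> expectation (\<lambda>\<omega>. exp (s * Y \<omega>))"
        by (rule integral_mono) (use V_int int V_le elim in auto)
      finally show ?case using r by (intro diff_right_mono mult_left_mono) auto
    qed
  qed
qed

lemma integrable_exp_iff_finite_nn_integral:
  assumes "Y \<in> borel_measurable M"
  shows "integrable M (\<lambda>\<omega>. exp (s * Y \<omega>)) \<longleftrightarrow> (\<integral>\<^sup>+\<omega>. exp (s * Y \<omega>) \<partial>M) < \<infinity>"
  using assms by (simp add: integrable_iff_bounded)

lemma integrable_exp_truncated:
  fixes Y :: "'a \<Rightarrow> real"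
  assumes "prob_space M" and [measurable]: "Y \<in> borel_measurable M"
    and int: "\<And>u. \<bar>u\<bar> \<le> d \<Longrightarrow> integrable M (\<lambda>\<omega>. exp (u * Y \<omega>))"
    and "s \<ge> - d"
  shows "integrable M (\<lambda>\<omega>. exp (s * min K (Y \<omega>)))"
proof -
  interpret prob_space M by fact
  show ?thesis
  proof (cases "s \<ge> 0")
    case True
    show ?thesis
      by (rule Bochner_Integration.integrable_bound[of _ "\<lambda>_. exp (s * K)"])
         (use True in \<open>auto intro!: mult_left_mono\<close>)
  next
    case False
    then have s: "\<bar>s\<bar> \<le> d" using \<open>s \<ge> - d\<close> by simp
    show ?thesis
      by (rule Bochner_Integration.integrable_bound[of _ "\<lambda>\<omega>. exp (s * K) + exp (s * Y \<omega>)"])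
         (use int[OF s] in \<open>auto simp: min_def\<close>)
  qed
qed

lemma integrable_exp_near_0_if_log_mgf_finite:
  assumes Y: "Y \<in> borel_measurable M"
    and "\<exists>U. open U \<and> 0 \<in> U \<and> (\<forall>s\<in>U. \<bar>log_mgf M Y s\<bar> \<noteq> \<infinity>)"
  shows "\<exists>d>0. \<forall>u. \<bar>u\<bar> \<le> d \<longrightarrow> integrable M (\<lambda>\<omega>. exp (u * Y \<omega>))"
proof -
  from assms(2) obtain U where U: "open U \<and> 0 \<in> U \<and> (\<forall>s\<in>U. \<bar>log_mgf M Y s\<bar> \<noteq> \<infinity>)" ..
  then have "\<exists>d>0. cball 0 d \<subseteq> U" using open_contains_cball_eq[of U] by simp
  then obtain d where d: "d > 0" "cball 0 d \<subseteq> U" by auto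
  have "integrable M (\<lambda>\<omega>. exp (u * Y \<omega>))" if "\<bar>u\<bar> \<le> d" for u
  proof -
    have "u \<in> U" using d(2) that by (auto simp: dist_norm)
    have "mgf M Y u \<noteq> \<infinity>"
    proof
      assume "mgf M Y u = \<infinity>"
      then have "log_mgf M Y u = \<infinity>" by (simp add: log_mgf_def ext_ln_def)
      moreover have "\<bar>log_mgf M Y u\<bar> \<noteq> \<infinity>" using U \<open>u \<in> U\<close> by simp
      ultimately show False by simp
    qed
    then show ?thesis
      using integrable_exp_iff_finite_nn_integral[OF Y, of u] by (simp add: mgf_def less_top[symmetric])
  qed
  then show ?thesis by (intro exI[of _ d] conjI allI impI d(1))
qed

locale cramer_streams = compound_poisson_streams +
  fixes c :: "nat \<Rightarrow> real"
  assumes exceeds: "i \<in> {1..I} \<Longrightarrow> prob {\<omega> \<in> space P. X i 1 \<omega> > c i} > 0"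
    and mgf_near_0: "i \<in> {1..I} \<Longrightarrow> \<exists>d>0. \<forall>u. \<bar>u\<bar> \<le> d \<longrightarrow> integrable P (\<lambda>\<omega>. exp (u * X i 1 \<omega>))"
begin

definition exponent :: "(real \<Rightarrow> real) \<Rightarrow> real \<Rightarrow> real" where
  "exponent g s = (\<Sum>i = 1..I. rate i * (expectation (\<lambda>\<omega>. exp (s * g (X i 1 \<omega>))) - 1) - c i * s)"

abbreviation drift :: real where "drift \<equiv> (\<Sum>i = 1..I. c i)"

lemma X1_measurable [measurable]: "i \<in> {1..I} \<Longrightarrow> X i 1 \<in> borel_measurable P"
  by (rule jump_random_variable) auto

lemma mgf_excess:
  assumes "t > 0" and g [measurable]: "g \<in> borel_measurable borel"
    and int: "\<And>i. i \<in> {1..I} \<Longrightarrow> integrable P (\<lambda>\<omega>. exp (s * g (X i 1 \<omega>)))"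
  shows "(\<integral>\<^sup>+\<omega>. exp (s * (total g t \<omega> - drift * t)) \<partial>P) = ennreal (exp (t * exponent g s))"
proof -
  have [measurable]: "total g t \<in> borel_measurable P"
    using assms by (intro total_measurable) auto
  have "(\<integral>\<^sup>+\<omega>. exp (s * (total g t \<omega> - drift * t)) \<partial>P)
      = (\<integral>\<^sup>+\<omega>. ennreal (exp (- (s * drift * t))) * ennreal (exp (s * total g t \<omega>)) \<partial>P)"
    by (intro nn_integral_cong) (simp add: ennreal_mult[symmetric] exp_add[symmetric] algebra_simps)
  also have "\<dots> = ennreal (exp (- (s * drift * t))) * (\<integral>\<^sup>+\<omega>. exp (s * total g t \<omega>) \<partial>P)"
    by (rule nn_integral_cmult) simp
  also have "(\<integral>\<^sup>+\<omega>. exp (s * total g t \<omega>) \<partial>P) = ennreal (exp (t * (\<Sum>i = 1..I.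
      rate i * (expectation (\<lambda>\<omega>. exp (s * g (X i 1 \<omega>))) - 1))))"
    by (rule mgf_total) (use assms int in \<open>auto intro: nn_integral_eq_integral\<close>)
  also have "ennreal (exp (- (s * drift * t))) * \<dots> = ennreal (exp (t * exponent g s))"
  proof -
    have "exponent g s = (\<Sum>i = 1..I. rate i * (expectation (\<lambda>\<omega>. exp (s * g (X i 1 \<omega>))) - 1)) - drift * s"
      unfolding exponent_def sum_subtractf sum_distrib_right ..
    then have "- (s * drift * t) + t * (\<Sum>i = 1..I.
        rate i * (expectation (\<lambda>\<omega>. exp (s * g (X i 1 \<omega>))) - 1)) = t * exponent g s"
      by (simp add: right_diff_distrib)
    then show ?thesis by (simp only: ennreal_mult[symmetric] exp_add[symmetric] exp_ge_zero)
  qed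
  finally show ?thesis .
qed

lemma chernoff_bound:
  assumes "s > 0" "t > 0"
    and int: "\<And>i. i \<in> {1..I} \<Longrightarrow> integrable P (\<lambda>\<omega>. exp (s * X i 1 \<omega>))"
  shows "prob {\<omega> \<in> space P. total (\<lambda>x. x) t \<omega> > drift * t} \<le> exp (t * exponent (\<lambda>x. x) s)"
proof -
  have [measurable]: "total (\<lambda>x. x) t \<in> borel_measurable P"
    using assms by (intro total_measurable) auto
  have "emeasure P {\<omega> \<in> space P. total (\<lambda>x. x) t \<omega> > drift * t}
      = (\<integral>\<^sup>+\<omega>. indicator {\<omega> \<in> space P. total (\<lambda>x. x) t \<omega> > drift * t} \<omega> \<partial>P)" by simp
  also have "\<dots> \<le> (\<integral>\<^sup>+\<omega>. exp (s * (total (\<lambda>x. x) t \<omega> - drift * t)) \<partial>P)"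
    using assms(1) by (intro nn_integral_mono) (auto split: split_indicator intro: ennreal_leI[of 1, simplified])
  also have "\<dots> = ennreal (exp (t * exponent (\<lambda>x. x) s))"
    using assms by (intro mgf_excess) auto
  finally show ?thesis by (simp add: emeasure_eq_measure)
qed

text \<open>
  Truncation from above. All the levels are positive, so that a jump which is positive stays
  positive; this keeps the exponent coercive at every level.
\<close>

definition level :: "nat \<Rightarrow> real \<Rightarrow> real" where "level n x = min (real (Suc n)) x"

lemma level_measurable [measurable]: "level n \<in> borel_measurable borel"
  unfolding level_def[abs_def] by measurable

lemma level_le: "level n x \<le> x" "m \<le> n \<Longrightarrow> level m x \<le> level n x"
  by (auto simp: level_def)

lemma integrable_exp_level:
  assumes "i \<in> {1..I}"
  obtains d where "d > 0" "\<And>s. s \<ge> - d \<Longrightarrow> integrable P (\<lambda>\<omega>. exp (s * level n (X i 1 \<omega>)))"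
proof -
  obtain d where d: "d > 0" "\<And>u. \<bar>u\<bar> \<le> d \<Longrightarrow> integrable P (\<lambda>\<omega>. exp (u * X i 1 \<omega>))"
    using mgf_near_0[OF assms] by blast
  show ?thesis
    using d integrable_exp_truncated[OF prob_space_axioms X1_measurable[OF assms] d(2)]
    by (intro that[of d]) (auto simp: level_def)
qed

lemma integrable_exp_level_nonneg:
  assumes "i \<in> {1..I}" "s \<ge> 0"
  shows "integrable P (\<lambda>\<omega>. exp (s * level n (X i 1 \<omega>)))"
  using integrable_exp_level[OF assms(1), of n] assms(2) by (metis neg_le_0_iff_le less_imp_le order_trans)

lemma exponent_level_differentiable:
  assumes "s \<ge> 0"
  shows "exponent (level n) differentiable (at s)"
proof -
  have "(\<lambda>u. expectation (\<lambda>\<omega>. exp (u * level n (X i 1 \<omega>)))) differentiable (at s)" if i: "i \<in> {1..I}" for i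
  proof -
    obtain d where d: "d > 0" "\<And>s. s \<ge> - d \<Longrightarrow> integrable P (\<lambda>\<omega>. exp (s * level n (X i 1 \<omega>)))"
      using integrable_exp_level[OF i, of n] by blast
    have "(\<lambda>\<omega>. level n (X i 1 \<omega>)) \<in> borel_measurable P" using i by measurable
    then have "((\<lambda>u. expectation (\<lambda>\<omega>. exp (u * level n (X i 1 \<omega>)))) has_real_derivative
        expectation (\<lambda>\<omega>. level n (X i 1 \<omega>) * exp (s * level n (X i 1 \<omega>)))) (at s)"
      using d(1) by (rule mgf_has_real_derivative) (use d(2) assms in auto)
    then show ?thesis by (auto simp: real_differentiable_def)
  qed
  then show ?thesis
    unfolding exponent_def[abs_def]
    by (intro differentiable_sum ballI differentiable_diff differentiable_mult differentiable_const
        differentiable_ident) auto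
qed

lemma exponent_level_at_top:
  assumes "I \<ge> 1"
  shows "filterlim (exponent (level n)) at_top at_top"
proof -
  have lim: "filterlim (\<lambda>s. rate i * (expectation (\<lambda>\<omega>. exp (s * level n (X i 1 \<omega>))) - 1) - c i * s) at_top at_top"
    if i: "i \<in> {1..I}" for i
  proof (rule compensated_mgf_at_top)
    show "(\<lambda>\<omega>. level n (X i 1 \<omega>)) \<in> borel_measurable P" using i by measurable
    show "c i < 0 \<or> prob {\<omega> \<in> space P. level n (X i 1 \<omega>) > 0} > 0"
    proof (cases "c i < 0")
      case False
      have "prob {\<omega> \<in> space P. X i 1 \<omega> > c i} \<le> prob {\<omega> \<in> space P. level n (X i 1 \<omega>) > 0}"
        using False i by (intro finite_measure_mono) (auto simp: level_def)
      with exceeds[OF i] show ?thesis by simp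
    qed simp
  qed (use i rate_pos integrable_exp_level_nonneg in auto)
  have "filterlim (\<lambda>s. \<Sum>i\<in>A. rate i * (expectation (\<lambda>\<omega>. exp (s * level n (X i 1 \<omega>))) - 1) - c i * s) at_top at_top"
    if "finite A" "A \<noteq> {}" "A \<subseteq> {1..I}" for A
    using that
  proof (induction A rule: finite_ne_induct)
    case (singleton i)
    then show ?case using lim by simp
  next
    case (insert i A)
    then show ?case using lim by (simp add: filterlim_at_top_add_at_top)
  qed
  from this[of "{1..I}"] assms show ?thesis unfolding exponent_def[abs_def] by auto
qed

lemma exponent_level_mono:
  assumes "s \<ge> 0" "m \<le> n"
  shows "exponent (level m) s \<le> exponent (level n) s"
  unfolding exponent_def
proof (intro sum_mono diff_right_mono mult_left_mono)
  fix i assume i: "i \<in> {1..I}"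
  show "expectation (\<lambda>\<omega>. exp (s * level m (X i 1 \<omega>))) \<le> expectation (\<lambda>\<omega>. exp (s * level n (X i 1 \<omega>)))"
    by (rule integral_mono)
       (use assms i in \<open>auto intro!: integrable_exp_level_nonneg mult_left_mono level_le\<close>)
  show "0 \<le> rate i" using rate_pos[OF i] by simp
qed

text \<open>
  Truncated jumps have a smaller aggregate, so a lower bound for their exceedance probability is one
  for the original jumps.
\<close>

lemma lower_bound_truncated:
  assumes "I \<ge> 1" and a: "\<And>s. s \<ge> 0 \<Longrightarrow> a < exponent (level n) s"
  shows "\<forall>\<^sub>F t in at_top. exp (t * a) \<le> prob {\<omega> \<in> space P. total (\<lambda>x. x) t \<omega> > drift * t}"
proof -
  have meas: "total (level n) t \<in> borel_measurable P" if "t > 0" for t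
    using that by (intro total_measurable) auto
  have "\<forall>\<^sub>F t in at_top. exp (t * a) \<le> prob {\<omega> \<in> space P. total (level n) t \<omega> - drift * t > 0}"
  proof (rule exponential_lower_bound[where L = "exponent (level n)"])
    show "(\<integral>\<^sup>+\<omega>. exp (u * (total (level n) t \<omega> - drift * t)) \<partial>P) = ennreal (exp (t * exponent (level n) u))"
      if "t > 0" "u \<ge> 0" for t u
      using that by (intro mgf_excess integrable_exp_level_nonneg) auto
  qed (use assms meas exponent_level_differentiable exponent_level_at_top in auto)
  then show ?thesis
    using eventually_gt_at_top[of 0]
  proof eventually_elim
    case (elim t)
    have [measurable]: "total (\<lambda>x. x) t \<in> borel_measurable P"
      using elim by (intro total_measurable) auto
    have le: "total (level n) t \<omega> \<le> total (\<lambda>x. x) t \<omega>" for \<omega>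
      unfolding total_def by (intro sum_mono level_le)
    have "prob {\<omega> \<in> space P. total (level n) t \<omega> - drift * t > 0}
        \<le> prob {\<omega> \<in> space P. total (\<lambda>x. x) t \<omega> > drift * t}"
      by (intro finite_measure_mono) (use order_less_le_trans[OF _ le] in auto)
    with elim(1) show ?case by linarith
  qed
qed

section \<open>The large deviation limit\<close>

lemma exponent_0 [simp]: "exponent g 0 = 0"
  by (simp add: exponent_def prob_space)

lemma integrable_exp_near_0:
  obtains d where "d > 0" "\<And>i s. i \<in> {1..I} \<Longrightarrow> \<bar>s\<bar> \<le> d \<Longrightarrow> integrable P (\<lambda>\<omega>. exp (s * X i 1 \<omega>))"
proof -
  define Q where "Q i d \<longleftrightarrow> d > 0 \<and> (\<forall>u. \<bar>u\<bar> \<le> d \<longrightarrow> integrable P (\<lambda>\<omega>. exp (u * X i 1 \<omega>)))" for i d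
  have "\<forall>i\<in>{1..I}. \<exists>d. Q i d"
    unfolding Q_def by (intro ballI mgf_near_0)
  from bchoice[OF this] obtain e where e: "\<forall>i\<in>{1..I}. Q i (e i)" ..
  have e_pos: "e i > 0" if "i \<in> {1..I}" for i
    using bspec[OF e that] unfolding Q_def by (rule conjunct1)
  have e_int: "integrable P (\<lambda>\<omega>. exp (u * X i 1 \<omega>))" if "i \<in> {1..I}" "\<bar>u\<bar> \<le> e i" for i u
    using bspec[OF e that(1)] that(2) unfolding Q_def by (elim conjE allE impE)
  define d where "d = Min (insert 1 (e ` {1..I}))"
  show ?thesis
  proof
    show "d > 0"
      unfolding d_def by (subst Min_gr_iff) (simp_all add: e_pos)
    fix i s assume i: "i \<in> {1..I}" and "\<bar>s\<bar> \<le> d"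
    moreover have "d \<le> e i" unfolding d_def using i by (intro Min_le) auto
    ultimately have "\<bar>s\<bar> \<le> e i" by linarith
    then show "integrable P (\<lambda>\<omega>. exp (s * X i 1 \<omega>))" by (rule e_int[OF i])
  qed
qed

lemma exponent_tendsto_0: "(exponent (\<lambda>x. x) \<longlongrightarrow> 0) (at_right 0)"
proof -
  obtain d where d: "d > 0" "\<And>i s. i \<in> {1..I} \<Longrightarrow> \<bar>s\<bar> \<le> d \<Longrightarrow> integrable P (\<lambda>\<omega>. exp (s * X i 1 \<omega>))"
    using integrable_exp_near_0 by blast
  have "isCont (\<lambda>u. expectation (\<lambda>\<omega>. exp (u * X i 1 \<omega>))) 0" if i: "i \<in> {1..I}" for i
    using mgf_has_real_derivative[OF X1_measurable[OF i] d(1), of 0] d(2)[OF i] by (auto intro: DERIV_isCont)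
  then have "isCont (exponent (\<lambda>x. x)) 0"
    unfolding exponent_def[abs_def] by (intro continuous_intros) auto
  then have "(exponent (\<lambda>x. x) \<longlongrightarrow> 0) (at 0)"
    unfolding isCont_def exponent_0 .
  then show ?thesis by (rule tendsto_mono[OF at_le, rotated]) simp
qed

text \<open>
  The truncated moments increase with the level. A bound on the exponent bounds each of them
  separately, since all the moments are nonnegative, so monotone convergence yields a finite
  limit.
\<close>

lemma exponent_level_tendsto:
  assumes "s \<ge> 0" and bound: "\<And>n. exponent (level n) s \<le> a" and i: "i \<in> {1..I}"
  shows "integrable P (\<lambda>\<omega>. exp (s * X i 1 \<omega>))"
    and "(\<lambda>n. expectation (\<lambda>\<omega>. exp (s * level n (X i 1 \<omega>)))) \<longlonglongrightarrow> expectation (\<lambda>\<omega>. exp (s * X i 1 \<omega>))"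
proof -
  define m where "m j n = expectation (\<lambda>\<omega>. exp (s * level n (X j 1 \<omega>)))" for j n
  have m_nonneg: "0 \<le> m j n" for j n by (simp add: m_def)
  have m_bound: "m i n \<le> (a + (\<Sum>j = 1..I. rate j + c j * s)) / rate i" for n
  proof -
    have "rate i * m i n \<le> (\<Sum>j = 1..I. rate j * m j n)"
      using i by (intro member_le_sum) (auto intro!: mult_nonneg_nonneg m_nonneg less_imp_le[OF rate_pos])
    also have "\<dots> = exponent (level n) s + (\<Sum>j = 1..I. rate j + c j * s)"
      unfolding exponent_def m_def sum.distrib[symmetric] by (intro sum.cong) (auto simp: right_diff_distrib)
    also have "\<dots> \<le> a + (\<Sum>j = 1..I. rate j + c j * s)" using bound by simp
    finally show ?thesis using rate_pos[OF i] by (simp add: field_simps)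
  qed
  have inc: "incseq (\<lambda>n. m i n)"
    unfolding m_def
    by (intro monoI integral_mono)
       (use assms(1) i in \<open>auto intro!: integrable_exp_level_nonneg mult_left_mono level_le\<close>)
  then obtain l where l: "(\<lambda>n. m i n) \<longlonglongrightarrow> l"
    using incseq_convergent[OF inc] m_bound by metis
  have ptw: "(\<lambda>n. exp (s * level n (X i 1 \<omega>))) \<longlonglongrightarrow> exp (s * X i 1 \<omega>)" for \<omega>
  proof -
    obtain n0 where n0: "X i 1 \<omega> \<le> real n0" using real_arch_simple by blast
    have "\<forall>\<^sub>F n in sequentially. exp (s * X i 1 \<omega>) = exp (s * level n (X i 1 \<omega>))"
      using eventually_ge_at_top[of n0] by eventually_elim (use n0 in \<open>auto simp: level_def min_def\<close>)
    then show ?thesis by (rule Lim_transform_eventually[OF tendsto_const])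
  qed
  have "integrable P (\<lambda>\<omega>. exp (s * X i 1 \<omega>)) \<and> expectation (\<lambda>\<omega>. exp (s * X i 1 \<omega>)) = l"
    using integrable_monotone_convergence[of P "\<lambda>n \<omega>. exp (s * level n (X i 1 \<omega>))" "\<lambda>\<omega>. exp (s * X i 1 \<omega>)" l]
      integral_monotone_convergence[of P "\<lambda>n \<omega>. exp (s * level n (X i 1 \<omega>))" "\<lambda>\<omega>. exp (s * X i 1 \<omega>)" l]
      ptw l i assms(1)
    by (auto simp: m_def integrable_exp_level_nonneg intro!: AE_I2 monoI mult_left_mono level_le)
  then show "integrable P (\<lambda>\<omega>. exp (s * X i 1 \<omega>))"
    "(\<lambda>n. expectation (\<lambda>\<omega>. exp (s * level n (X i 1 \<omega>)))) \<longlonglongrightarrow> expectation (\<lambda>\<omega>. exp (s * X i 1 \<omega>))"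
    using l by (auto simp: m_def)
qed

text \<open>
  The exchange of limit and infimum. The coercive exponent of level \<open>0\<close> confines all the sublevel
  sets to one compact interval, and they shrink as the level grows. A point common to all of them is
  not \<open>0\<close>, because the exponent vanishes there and \<open>a < 0\<close>; so it contradicts the hypothesis.
\<close>

lemma ex_level_above:
  assumes "I \<ge> 1" "a < 0"
    and above: "\<And>s. s > 0 \<Longrightarrow> (\<And>i. i \<in> {1..I} \<Longrightarrow> integrable P (\<lambda>\<omega>. exp (s * X i 1 \<omega>))) \<Longrightarrow> a < exponent (\<lambda>x. x) s"
  shows "\<exists>n. \<forall>s\<ge>0. a < exponent (level n) s"
proof (rule ccontr)
  assume neg: "\<not> ?thesis"
  obtain R where R: "\<And>s. s \<ge> R \<Longrightarrow> a < exponent (level 0) s"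
    using exponent_level_at_top[OF assms(1), of 0]
    by (auto simp: filterlim_at_top_dense eventually_at_top_linorder)
  define C where "C n = {0..R} \<inter> exponent (level n) -` {..a}" for n
  have "\<Inter>(range C) \<noteq> {}"
  proof (rule compact_nest)
    fix n
    have "continuous_on {0..R} (exponent (level n))"
      by (intro continuous_at_imp_continuous_on ballI differentiable_imp_continuous_within
          exponent_level_differentiable) simp
    then show "compact (C n)"
      unfolding C_def compact_eq_bounded_closed
      using continuous_closed_preimage[OF _ closed_atLeastAtMost closed_atMost]
      by (auto intro: bounded_subset[of "{0..R}"])
    obtain s where s: "s \<ge> 0" "exponent (level n) s \<le> a" using neg by (auto simp: not_less)
    then have "exponent (level 0) s \<le> a" using exponent_level_mono[of s 0 n] by simp
    then have "s \<le> R" using R[of s] by linarith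
    with s show "C n \<noteq> {}" by (auto simp: C_def)
  next
    fix m n :: nat assume "m \<le> n"
    then show "C n \<subseteq> C m" using exponent_level_mono[of _ m n] by (force simp: C_def)
  qed
  then obtain s where "s \<in> C n" for n by blast
  then have s: "s \<ge> 0" "exponent (level n) s \<le> a" for n by (auto simp: C_def)
  have "s \<noteq> 0" using s(2)[of 0] \<open>a < 0\<close> by auto
  then have "s > 0" using s(1) by simp
  have "(\<lambda>n. exponent (level n) s) \<longlonglongrightarrow> exponent (\<lambda>x. x) s"
    unfolding exponent_def
    by (intro tendsto_sum tendsto_diff tendsto_mult tendsto_const exponent_level_tendsto(2)[OF s(1) s(2)])
  then have "exponent (\<lambda>x. x) s \<le> a"
    using s(2) by (intro LIMSEQ_le_const2) auto
  moreover have "a < exponent (\<lambda>x. x) s"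
    using exponent_level_tendsto(1)[OF s(1) s(2)] \<open>s > 0\<close> by (intro above)
  ultimately show False by simp
qed

text \<open>
  The expression under the infimum, which is \<open>\<infinity>\<close> as soon as one of the exponential moments is.
\<close>

definition extended_exponent :: "real \<Rightarrow> ereal" where
  "extended_exponent s = (\<Sum>i = 1..I. ereal (rate i) * (enn2ereal (mgf P (X i 1) s) - 1) - ereal (c i * s))"

lemma extended_exponent_finite:
  assumes "\<And>i. i \<in> {1..I} \<Longrightarrow> integrable P (\<lambda>\<omega>. exp (s * X i 1 \<omega>))"
  shows "extended_exponent s = ereal (exponent (\<lambda>x. x) s)"
proof -
  have "ereal (rate i) * (enn2ereal (mgf P (X i 1) s) - 1) - ereal (c i * s)
      = ereal (rate i * (expectation (\<lambda>\<omega>. exp (s * X i 1 \<omega>)) - 1) - c i * s)" if i: "i \<in> {1..I}" for i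
  proof -
    have "mgf P (X i 1) s = ennreal (expectation (\<lambda>\<omega>. exp (s * X i 1 \<omega>)))"
      unfolding mgf_def by (rule nn_integral_eq_integral) (use assms[OF i] in auto)
    then have "enn2ereal (mgf P (X i 1) s) = ereal (expectation (\<lambda>\<omega>. exp (s * X i 1 \<omega>)))"
      by (simp add: enn2ereal_ennreal)
    then show ?thesis by (simp add: one_ereal_def)
  qed
  then show ?thesis unfolding extended_exponent_def exponent_def by (simp add: sum_ereal[symmetric] del: sum_ereal)
qed

lemma extended_exponent_infinite:
  assumes "i \<in> {1..I}" "\<not> integrable P (\<lambda>\<omega>. exp (s * X i 1 \<omega>))"
  shows "extended_exponent s = \<infinity>"
proof -
  have "mgf P (X i 1) s = \<infinity>"
    using assms(2) integrable_exp_iff_finite_nn_integral[OF X1_measurable[OF assms(1)], of s]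
    by (simp add: mgf_def less_top[symmetric])
  then have "ereal (rate i) * (enn2ereal (mgf P (X i 1) s) - 1) - ereal (c i * s) = \<infinity>"
    using rate_pos[OF assms(1)] by (simp add: one_ereal_def)
  then show ?thesis using assms(1) unfolding extended_exponent_def by (subst sum_Pinfty) auto
qed

text \<open>
  The exponent is continuous at \<open>0\<close> with value \<open>0\<close>, so excluding \<open>s = 0\<close> from the infimum does not
  raise it above \<open>0\<close>.
\<close>

lemma INF_extended_exponent_le_0: "(INF s\<in>{0<..}. extended_exponent s) \<le> 0"
proof (rule ccontr)
  assume "\<not> ?thesis"
  then obtain b where b: "0 < ereal b" "ereal b < (INF s\<in>{0<..}. extended_exponent s)"
    using ereal_dense2[of 0 "INF s\<in>{0<..}. extended_exponent s"] unfolding not_le by blast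
  obtain d where d: "d > 0" "\<And>i s. i \<in> {1..I} \<Longrightarrow> \<bar>s\<bar> \<le> d \<Longrightarrow> integrable P (\<lambda>\<omega>. exp (s * X i 1 \<omega>))"
    using integrable_exp_near_0 by blast
  have "\<forall>\<^sub>F s in at_right 0. exponent (\<lambda>x. x) s < b"
    using order_tendstoD(2)[OF exponent_tendsto_0] b(1) by simp
  moreover have "\<forall>\<^sub>F s in at_right 0. s \<in> {0<..<d}"
    using d(1) by (rule eventually_at_right_real)
  ultimately have "\<forall>\<^sub>F s in at_right 0. exponent (\<lambda>x. x) s < b \<and> s \<in> {0<..<d}"
    by (rule eventually_conj)
  then obtain s where s: "exponent (\<lambda>x. x) s < b" "0 < s" "s < d"
    using eventually_happens'[OF trivial_limit_at_right_real] by force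
  have "(INF s\<in>{0<..}. extended_exponent s) \<le> extended_exponent s" using s by (intro INF_lower) simp
  also have "extended_exponent s = ereal (exponent (\<lambda>x. x) s)"
    using s d(2) by (intro extended_exponent_finite) auto
  also have "\<dots> < ereal b" using s by simp
  finally show False using b(2) by simp
qed

theorem total_exceedance_rate:
  assumes "I \<ge> 1"
  shows "((\<lambda>t. ereal (1 / t) * ext_ln (emeasure P {\<omega> \<in> space P. total (\<lambda>x. x) t \<omega> > drift * t}))
          \<longlongrightarrow> (INF s\<in>{0<..}. extended_exponent s)) at_top"
proof -
  define p where "p t = prob {\<omega> \<in> space P. total (\<lambda>x. x) t \<omega> > drift * t}" for t
  have ln_p: "ext_ln (emeasure P {\<omega> \<in> space P. total (\<lambda>x. x) t \<omega> > drift * t})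
      = (if p t = 0 then - \<infinity> else ereal (ln (p t)))" for t
    by (simp add: ext_ln_def p_def emeasure_eq_measure)
  show ?thesis
    unfolding ln_p
  proof (rule order_tendstoI)
    fix x assume "x < (INF s\<in>{0<..}. extended_exponent s)"
    then obtain b where b: "x < ereal b" "ereal b < (INF s\<in>{0<..}. extended_exponent s)"
      using ereal_dense2 by blast
    from ereal_dense2[OF b(1)] obtain a where "x < ereal a" "ereal a < ereal b" by blast
    with b(2) have ab: "x < ereal a" "a < b" "ereal b < (INF s\<in>{0<..}. extended_exponent s)" by simp_all
    have "b < 0" using order_less_le_trans[OF ab(3) INF_extended_exponent_le_0] by simp
    moreover have "b < exponent (\<lambda>x. x) s"
      if "s > 0" "\<And>i. i \<in> {1..I} \<Longrightarrow> integrable P (\<lambda>\<omega>. exp (s * X i 1 \<omega>))" for s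
      using order_less_le_trans[OF ab(3) INF_lower[of s]] that extended_exponent_finite[of s] by simp
    ultimately obtain n where n: "\<And>s. s \<ge> 0 \<Longrightarrow> b < exponent (level n) s"
      using ex_level_above[OF assms, of b] by blast
    have "\<forall>\<^sub>F t in at_top. exp (t * b) \<le> p t"
      unfolding p_def using assms n by (rule lower_bound_truncated)
    then show "\<forall>\<^sub>F t in at_top. x < ereal (1 / t) * (if p t = 0 then - \<infinity> else ereal (ln (p t)))"
      using eventually_gt_at_top[of 0]
    proof eventually_elim
      case (elim t)
      have pos: "p t > 0" using exp_gt_zero elim(1) by (rule order_less_le_trans)
      then have "t * b \<le> ln (p t)" using elim(1) ln_ge_iff by blast
      moreover have "t * a < t * b" using ab(2) elim(2) by simp
      ultimately have "t * a < ln (p t)" by linarith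
      then have "a < 1 / t * ln (p t)" using elim(2) by (simp add: field_simps)
      then have "ereal a < ereal (1 / t) * ereal (ln (p t))" by simp
      with ab(1) have "x < ereal (1 / t) * ereal (ln (p t))" by (rule order_less_trans)
      then show ?case using pos by simp
    qed
  next
    fix x assume "(INF s\<in>{0<..}. extended_exponent s) < x"
    then obtain s where s: "s > 0" "extended_exponent s < x" by (auto simp: INF_less_iff)
    have int: "integrable P (\<lambda>\<omega>. exp (s * X i 1 \<omega>))" if "i \<in> {1..I}" for i
    proof (rule ccontr)
      assume "\<not> integrable P (\<lambda>\<omega>. exp (s * X i 1 \<omega>))"
      with that have "extended_exponent s = \<infinity>" by (rule extended_exponent_infinite)
      with s(2) show False by simp
    qed
    have less: "ereal (exponent (\<lambda>x. x) s) < x" using s(2) extended_exponent_finite[OF int] by simp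
    show "\<forall>\<^sub>F t in at_top. ereal (1 / t) * (if p t = 0 then - \<infinity> else ereal (ln (p t))) < x"
      using eventually_gt_at_top[of 0]
    proof eventually_elim
      case (elim t)
      show ?case
      proof (cases "p t = 0")
        case True
        then show ?thesis using elim less by auto
      next
        case False
        then have pos: "p t > 0" by (simp add: p_def less_le)
        have "p t \<le> exp (t * exponent (\<lambda>x. x) s)"
          unfolding p_def using s(1) elim int by (rule chernoff_bound)
        then have "ln (p t) \<le> ln (exp (t * exponent (\<lambda>x. x) s))"
          using pos by (subst ln_le_cancel_iff) simp_all
        then have "ln (p t) \<le> t * exponent (\<lambda>x. x) s" by simp
        then have "1 / t * ln (p t) \<le> exponent (\<lambda>x. x) s" using elim by (simp add: field_simps)
        then have "ereal (1 / t) * ereal (ln (p t)) \<le> ereal (exponent (\<lambda>x. x) s)" by simp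
        then have "ereal (1 / t) * ereal (ln (p t)) < x" using less by (rule order_le_less_trans)
        then show ?thesis using False by simp
      qed
    qed
  qed
qed

end

theorem theorem1:
  fixes P :: "'a measure"
    and I :: nat
    and c rate :: "nat \<Rightarrow> real"
    and N :: "nat \<Rightarrow> real \<Rightarrow> 'a \<Rightarrow> nat"
    and X :: "nat \<Rightarrow> nat \<Rightarrow> 'a \<Rightarrow> real"
  assumes "prob_space P"
    and "I \<ge> 1"
    and "\<And>i. i \<in> {1..I} \<Longrightarrow> rate i > 0"
    and "\<And>i. i \<in> {1..I} \<Longrightarrow> poisson_process P (rate i) (N i)"
    and "\<And>i. i \<in> {1..I} \<Longrightarrow> iid_real P (X i) {1..}"
    and "\<And>i. i \<in> {1..I} \<Longrightarrow> (\<integral>\<omega>. X i 1 \<omega> \<partial>P) < c i"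
    and "\<And>i. i \<in> {1..I} \<Longrightarrow> measure P {\<omega> \<in> space P. X i 1 \<omega> > c i} > 0"
    and "\<And>i. i \<in> {1..I} \<Longrightarrow>
           \<exists>U. open U \<and> 0 \<in> U \<and> (\<forall>s\<in>U. \<bar>log_mgf P (X i 1) s\<bar> \<noteq> \<infinity>)"
    and "prob_space.indep_sets P
           (case_sum
              (\<lambda>i. process_events P (count_space UNIV) {0..} (N i))
              (\<lambda>i. process_events P borel {1..} (X i)))
           ({1..I} <+> {1..I})"
  shows "((\<lambda>t :: real. ereal (1 / t) *
            ext_ln (emeasure P {\<omega> \<in> space P.
              (\<Sum>i = 1..I. \<Sum>k = 1..N i t \<omega>. X i k \<omega>) > (\<Sum>i = 1..I. c i) * t}))
          \<longlongrightarrow> (INF s\<in>{0<..}. \<Sum>i = 1..I.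
                 (ereal (rate i) * (enn2ereal (mgf P (X i 1) s) - 1) - ereal (c i * s))))
         at_top"
proof -
  interpret prob_space P by fact
  interpret compound_poisson_streams P I rate N X
    by unfold_locales (fact assms(3,4,5,9))+
  have near_0: "\<exists>d>0. \<forall>u. \<bar>u\<bar> \<le> d \<longrightarrow> integrable P (\<lambda>\<omega>. exp (u * X i 1 \<omega>))" if i: "i \<in> {1..I}" for i
    using jump_random_variable[OF i order_refl] assms(8)[OF i]
    by (rule integrable_exp_near_0_if_log_mgf_finite)
  interpret cramer_streams P I rate N X c
    by unfold_locales (fact assms(7) near_0)+
  show ?thesis
    using total_exceedance_rate[OF assms(2)] unfolding total_def extended_exponent_def .
qed

end
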